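(* Let $n\equiv2\pmod4$, $n\ge6$. For $1\le l\le\frac{n-2}{4}$ let $\mathfrak{b}_l=\mathrm{span}_{\mathbb{C}}\{a_l,b_l,c_l,d_l\}\subseteq\mathrm{sol}_{A_n^2}$ and $\mathfrak{a}_k=\bigoplus_{l\ge k}\mathfrak{b}_l$. Then: (1) for any $k$, $\mathfrak{b}_k$ and $\mathfrak{a}_k$ are Lie ideals of $\mathrm{sol}_{A_n^2}$; (2) $[\mathfrak{a}_k,\mathfrak{a}_k]\subseteq\mathfrak{a}_{k+1}$; (3) $\mathfrak{a}=\mathfrak{a}_1$ is an abelian Lie ideal of $\mathrm{sol}_{A_n^2}$, and thus also nilpotent; (4) the Lie algebra generated by $h_1,h_2,e,f$ is isomorphic to $\mathfrak{sl}_2(\mathbb{C})\oplus\mathbb{C}$.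
   Context: $A_n$ is the $n\times n$ complex matrix with $(A_n)_{i,i+1}=1$ for $1\le i\le n-1$ and zeros elsewhere, and $A_n^2$ is its square. $\mathrm{sol}_{A_n^2}=\{X\in M_n(\mathbb{C}) : X^tA_n^2+A_n^2X=0\}$ with bracket $[X,Y]=XY-YX$. $E_{i,j}$ denotes the $n\times n$ matrix unit, with the convention $E_{i,j}=0$ if $i>n$ or $j>n$. The following elements belong to $\mathrm{sol}_{A_n^2}$: $h_1=\sum_{l=0}^{(n-2)/4}(E_{1+4l,1+4l}-E_{3+4l,3+4l})$, $h_2=\sum_{l=0}^{(n-2)/4}(E_{2+4l,2+4l}-E_{4+4l,4+4l})$, $e=\sum_{l=0}^{(n-2)/4}(E_{1+4l,2+4l}-E_{4+4l,3+4l})$, $f=\sum_{l=0}^{(n-2)/4}(E_{2+4l,1+4l}-E_{3+4l,4+4l})$, and for $k=1,\dots,\frac{n-2}{4}$: $a_k=\sum_{l=0}^{(n-2-4k)/4}(E_{1+4l,-1+4l+4k}-E_{1+4l+4k,3+4l})$, $b_k=\sum_{l=0}^{(n-2-4k)/4}(E_{1+4l,4l+4k}-E_{2+4l+4k,3+4l})$, $c_k=\sum_{l=0}^{(n-2-4k)/4}(E_{2+4l,-1+4l+4k}-E_{1+4l+4k,4+4l})$, $d_k=\sum_{l=0}^{(n-2-4k)/4}(E_{2+4l,4l+4k}-E_{2+4l+4k,4+4l})$. An empty sum $\mathfrak{a}_k$ (for $k>\frac{n-2}{4}$) is $0$. *)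

theory Defs
  imports Complex_Main "Jordan_Normal_Form.VS_Connect" "Jordan_Normal_Form.Matrix"
begin

subsection \<open>Lie algebras over a field\<close>

text \<open>The fields \<open>mult\<close> and \<open>one\<close>, inherited through the module record, play no role: the locales
  \<^locale>\<open>vectorspace\<close> and \<^locale>\<open>subspace\<close> do not constrain them.\<close>

record ('a, 'b) lie = "('a, 'b) module" +
  bracket :: "'b \<Rightarrow> 'b \<Rightarrow> 'b"

locale lie_algebra = vectorspace K L for K :: "('a, 'k) ring_scheme" (structure)
    and L :: "('a, 'b, 'l) lie_scheme" (structure) +
  assumes bracket_closed: "\<lbrakk>x \<in> carrier L; y \<in> carrier L\<rbrakk> \<Longrightarrow> bracket L x y \<in> carrier L"
    and bracket_add_left: "\<lbrakk>x \<in> carrier L; y \<in> carrier L; z \<in> carrier L\<rbrakk>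
      \<Longrightarrow> bracket L (x \<oplus>\<^bsub>L\<^esub> y) z = bracket L x z \<oplus>\<^bsub>L\<^esub> bracket L y z"
    and bracket_add_right: "\<lbrakk>x \<in> carrier L; y \<in> carrier L; z \<in> carrier L\<rbrakk>
      \<Longrightarrow> bracket L x (y \<oplus>\<^bsub>L\<^esub> z) = bracket L x y \<oplus>\<^bsub>L\<^esub> bracket L x z"
    and bracket_smult_left: "\<lbrakk>c \<in> carrier K; x \<in> carrier L; y \<in> carrier L\<rbrakk>
      \<Longrightarrow> bracket L (c \<odot>\<^bsub>L\<^esub> x) y = c \<odot>\<^bsub>L\<^esub> bracket L x y"
    and bracket_smult_right: "\<lbrakk>c \<in> carrier K; x \<in> carrier L; y \<in> carrier L\<rbrakk>
      \<Longrightarrow> bracket L x (c \<odot>\<^bsub>L\<^esub> y) = c \<odot>\<^bsub>L\<^esub> bracket L x y"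
    and bracket_self: "x \<in> carrier L \<Longrightarrow> bracket L x x = \<zero>\<^bsub>L\<^esub>"
    and jacobi: "\<lbrakk>x \<in> carrier L; y \<in> carrier L; z \<in> carrier L\<rbrakk>
      \<Longrightarrow> bracket L x (bracket L y z) \<oplus>\<^bsub>L\<^esub> bracket L y (bracket L z x)
          \<oplus>\<^bsub>L\<^esub> bracket L z (bracket L x y) = \<zero>\<^bsub>L\<^esub>"

locale lie_subalgebra = lie_algebra K L + subspace K H L
    for K :: "('a, 'k) ring_scheme" (structure) and H
      and L :: "('a, 'b, 'l) lie_scheme" (structure) +
  assumes subalgebra_closed: "\<lbrakk>x \<in> H; y \<in> H\<rbrakk> \<Longrightarrow> bracket L x y \<in> H"

locale lie_ideal = lie_algebra K L + subspace K I L
    for K :: "('a, 'k) ring_scheme" (structure) and I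
      and L :: "('a, 'b, 'l) lie_scheme" (structure) +
  assumes ideal_closed: "\<lbrakk>x \<in> carrier L; y \<in> I\<rbrakk> \<Longrightarrow> bracket L x y \<in> I"

lemma lie_subalgebra_is_lie: assumes "lie_subalgebra K H L" shows "lie_algebra K (L\<lparr>carrier := H\<rparr>)"
proof -
  interpret S: lie_subalgebra K H L by fact
  have "vectorspace K (L\<lparr>carrier := H\<rparr>)" using S.subspace_is_vs S.subspace_axioms by auto
  moreover have "H \<subseteq> carrier L" using S.submod by (auto simp: submodule_def)
  ultimately show ?thesis
    unfolding lie_algebra_def lie_algebra_axioms_def
    by (auto simp: subset_iff S.subalgebra_closed S.bracket_add_left S.bracket_add_right S.bracket_smult_left
       S.bracket_smult_right S.bracket_self S.jacobi)
qed

definition lie_generated ::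
  "('a, 'k) ring_scheme \<Rightarrow> ('a, 'b, 'l) lie_scheme \<Rightarrow> 'b set \<Rightarrow> 'b set" where
  "lie_generated K L S = \<Inter>{H. lie_subalgebra K H L \<and> S \<subseteq> H}"

definition bracket_space ::
  "('a, 'k) ring_scheme \<Rightarrow> ('a, 'b, 'l) lie_scheme \<Rightarrow> 'b set \<Rightarrow> 'b set \<Rightarrow> 'b set" where
  "bracket_space K L U V =
     LinearCombinations.module.span K L {bracket L u v | u v. u \<in> U \<and> v \<in> V}"

definition lie_abelian :: "('a, 'b, 'l) lie_scheme \<Rightarrow> bool" where
  "lie_abelian L \<longleftrightarrow> (\<forall>x\<in>carrier L. \<forall>y\<in>carrier L. bracket L x y = \<zero>\<^bsub>L\<^esub>)"

fun lower_central_series ::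
  "('a, 'k) ring_scheme \<Rightarrow> ('a, 'b, 'l) lie_scheme \<Rightarrow> nat \<Rightarrow> 'b set" where
  "lower_central_series K L 0 = carrier L"
| "lower_central_series K L (Suc i) =
     bracket_space K L (carrier L) (lower_central_series K L i)"

definition lie_nilpotent :: "('a, 'k) ring_scheme \<Rightarrow> ('a, 'b, 'l) lie_scheme \<Rightarrow> bool" where
  "lie_nilpotent K L \<longleftrightarrow> (\<exists>i. lower_central_series K L i = {\<zero>\<^bsub>L\<^esub>})"

definition lie_isomorphic ::
  "('a, 'k) ring_scheme \<Rightarrow> ('a, 'b, 'l) lie_scheme \<Rightarrow> ('a, 'c, 'm) lie_scheme \<Rightarrow> bool" where
  "lie_isomorphic K L M \<longleftrightarrow> lie_algebra K L \<and> lie_algebra K M \<and>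
     (\<exists>\<phi>. linear_map K L M \<phi> \<and> bij_betw \<phi> (carrier L) (carrier M) \<and>
       (\<forall>x\<in>carrier L. \<forall>y\<in>carrier L. \<phi> (bracket L x y) = bracket M (\<phi> x) (\<phi> y)))"

definition lie_direct_sum ::
  "('a, 'b, 'l) lie_scheme \<Rightarrow> ('a, 'c, 'm) lie_scheme \<Rightarrow> ('a, 'b \<times> 'c) lie" where
  "lie_direct_sum L M = module.extend (direct_sum L M)
     (lie.fields (\<lambda>x y. (bracket L (fst x) (fst y), bracket M (snd x) (snd y))))"

text \<open>The sum of a finite family of subspaces, and the condition for this sum to be direct.\<close>

definition family_sum :: "('a, 'b, 'l) module_scheme \<Rightarrow> 'i set \<Rightarrow> ('i \<Rightarrow> 'b set) \<Rightarrow> 'b set" where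
  "family_sum V I W = {finsum V v I | v. v \<in> Pi I W}"

definition family_direct :: "('a, 'b, 'l) module_scheme \<Rightarrow> 'i set \<Rightarrow> ('i \<Rightarrow> 'b set) \<Rightarrow> bool" where
  "family_direct V I W \<longleftrightarrow>
     (\<forall>v \<in> Pi I W. finsum V v I = \<zero>\<^bsub>V\<^esub> \<longrightarrow> (\<forall>i\<in>I. v i = \<zero>\<^bsub>V\<^esub>))"

subsection \<open>The complex Lie algebras involved\<close>

abbreviation CC :: "complex ring" where "CC \<equiv> class_ring"

definition gl :: "nat \<Rightarrow> (complex, complex mat) lie" where
  "gl n = module.extend (module_mat TYPE(complex) n n) (lie.fields (\<lambda>X Y. X * Y - Y * X))"

lemma gl_simps [simp]:
  "carrier (gl n) = carrier_mat n n" "zero (gl n) = 0\<^sub>m n n" "add (gl n) = (+)"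
  "smult (gl n) = (\<cdot>\<^sub>m)" "bracket (gl n) = (\<lambda>X Y. X * Y - Y * X)"
  by (simp_all add: gl_def module.defs lie.defs module_mat_def)

lemma gl_vs: "vectorspace CC (gl n)"
proof -
  interpret M: vectorspace CC "module_mat TYPE(complex) n n" by (rule matrix_vs)
  have ag: "abelian_group (gl n)"
  proof (rule abelian_groupI)
    fix x assume x: "x \<in> carrier (gl n)"
    then show "\<exists>y\<in>carrier (gl n). y \<oplus>\<^bsub>gl n\<^esub> x = \<zero>\<^bsub>gl n\<^esub>"
      by (intro bexI[of _ "- x"]) (auto)
  qed (auto simp: ac_simps)
  then show ?thesis
    unfolding vectorspace_def Module.module_def Module.module_axioms_def
    using class_field class_cring.is_cring
    by (auto simp: add_smult_distrib_right_mat add_smult_distrib_left_mat)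
qed

lemma gl_lie_algebra: "lie_algebra CC (gl n)"
proof -
  interpret vectorspace CC "gl n" by (rule gl_vs)
  show ?thesis
  proof
    fix x y z assume "x \<in> carrier (gl n)" "y \<in> carrier (gl n)" "z \<in> carrier (gl n)"
    then have C[simp]: "x \<in> carrier_mat n n" "y \<in> carrier_mat n n" "z \<in> carrier_mat n n" by auto
    show "bracket (gl n) (x \<oplus>\<^bsub>gl n\<^esub> y) z = bracket (gl n) x z \<oplus>\<^bsub>gl n\<^esub> bracket (gl n) y z"
      apply (simp add: add_mult_distrib_mat[OF C] mult_add_distrib_mat[OF C(3,1,2)])
      by (intro eq_matI, auto simp: C[THEN carrier_matD(1)] C[THEN carrier_matD(2)] simp del: index_mult_mat(1))
    show "bracket (gl n) x (y \<oplus>\<^bsub>gl n\<^esub> z) = bracket (gl n) x y \<oplus>\<^bsub>gl n\<^esub> bracket (gl n) x z"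
      apply (simp add: add_mult_distrib_mat[OF C(2,3,1)] mult_add_distrib_mat[OF C])
      by (intro eq_matI, auto simp: C[THEN carrier_matD(1)] C[THEN carrier_matD(2)] simp del: index_mult_mat(1))
    have P: "p * q \<in> carrier_mat n n" if "p \<in> carrier_mat n n" "q \<in> carrier_mat n n"
      for p q :: "complex mat"
      using that by simp
    have expand: "p * (q * r - r * q) - (q * r - r * q) * p
        = (p * q * r - p * r * q) - (q * r * p - r * q * p)"
      if [simp]: "p \<in> carrier_mat n n" "q \<in> carrier_mat n n" "r \<in> carrier_mat n n"
      for p q r :: "complex mat"
      using mult_minus_distrib_mat[OF that(1) P[OF that(2,3)] P[OF that(3,2)]]
        minus_mult_distrib_mat[OF P[OF that(2,3)] P[OF that(3,2)] that(1)]
        assoc_mult_mat[OF that(1,2,3)] assoc_mult_mat[OF that(1,3,2)] by simp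
    show "bracket (gl n) x (bracket (gl n) y z) \<oplus>\<^bsub>gl n\<^esub> bracket (gl n) y (bracket (gl n) z x)
          \<oplus>\<^bsub>gl n\<^esub> bracket (gl n) z (bracket (gl n) x y) = \<zero>\<^bsub>gl n\<^esub>"
      unfolding gl_simps expand[OF C] expand[OF C(2,3,1)] expand[OF C(3,1,2)]
      by (rule eq_matI)
        (simp_all add: C[THEN carrier_matD(1)] C[THEN carrier_matD(2)] del: index_mult_mat(1))
  next
    fix k x y assume "x \<in> carrier (gl n)" "y \<in> carrier (gl n)"
    then have C: "x \<in> carrier_mat n n" "y \<in> carrier_mat n n" by auto
    show "bracket (gl n) (k \<odot>\<^bsub>gl n\<^esub> x) y = k \<odot>\<^bsub>gl n\<^esub> bracket (gl n) x y"
      "bracket (gl n) x (k \<odot>\<^bsub>gl n\<^esub> y) = k \<odot>\<^bsub>gl n\<^esub> bracket (gl n) x y"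
      unfolding gl_simps mult_smult_assoc_mat[OF C] mult_smult_distrib[OF C(2,1)]
        mult_smult_assoc_mat[OF C(2,1)] mult_smult_distrib[OF C]
      by (rule eq_matI; simp add: C[THEN carrier_matD(1)] C[THEN carrier_matD(2)] right_diff_distrib
          del: index_mult_mat(1))+
  qed auto
qed

definition sl :: "nat \<Rightarrow> (complex, complex mat) lie" where
  "sl n = (gl n)\<lparr>carrier := {X \<in> carrier_mat n n. (\<Sum>i<n. X $$ (i, i)) = 0}\<rparr>"

definition lie_C :: "(complex, complex) lie" where
  "lie_C = \<lparr>carrier = UNIV, mult = (*), one = 1, zero = 0, add = (+), smult = (*),
            bracket = (\<lambda>_ _. 0)\<rparr>"

definition sol :: "nat \<Rightarrow> complex mat \<Rightarrow> (complex, complex mat) lie" where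
  "sol n B = (gl n)\<lparr>carrier := {X \<in> carrier_mat n n. transpose_mat X * B + B * X = 0\<^sub>m n n}\<rparr>"

lemma sol_lie_subalgebra: assumes B: "B \<in> carrier_mat n n" shows "lie_subalgebra CC (carrier (sol n B)) (gl n)"
proof -
  interpret lie_algebra CC "gl n" by (rule gl_lie_algebra)
  have sm: "submodule CC (carrier (sol n B)) (gl n)"
  proof
    show "carrier (sol n B) \<subseteq> carrier (gl n)" by (auto simp: sol_def)
  next
    fix X Y assume "X \<in> carrier (sol n B)" "Y \<in> carrier (sol n B)"
    then have X: "X \<in> carrier_mat n n" "Y \<in> carrier_mat n n"
      and e: "transpose_mat X * B + B * X = 0\<^sub>m n n" "transpose_mat Y * B + B * Y = 0\<^sub>m n n" by (auto simp: sol_def)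
    have "transpose_mat (X+Y) * B + B * (X+Y) = (transpose_mat X * B + B * X) + (transpose_mat Y * B + B * Y)"
      using X B by (simp add: transpose_add add_mult_distrib_mat[of _ n n] mult_add_distrib_mat[of _ n n], intro eq_matI, auto)
    then show "X \<oplus>\<^bsub>gl n\<^esub> Y \<in> carrier (sol n B)" using X e by (auto simp: sol_def)
  next
    show "\<zero>\<^bsub>gl n\<^esub> \<in> carrier (sol n B)" using B by (auto simp: sol_def)
  next
    fix c X assume "X \<in> carrier (sol n B)"
    then have X: "X \<in> carrier_mat n n"
      and e: "transpose_mat X * B + B * X = 0\<^sub>m n n" by (auto simp: sol_def)
    have "transpose_mat (c \<cdot>\<^sub>m X) * B + B * (c \<cdot>\<^sub>m X) = c \<cdot>\<^sub>m (transpose_mat X * B + B * X)"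
      using X B by (intro eq_matI) (auto simp: algebra_simps)
    then show "c \<odot>\<^bsub>gl n\<^esub> X \<in> carrier (sol n B)" using X e by (auto simp: sol_def)
  qed
  have closed: "bracket (gl n) X Y \<in> carrier (sol n B)"
    if "X \<in> carrier (sol n B)" "Y \<in> carrier (sol n B)" for X Y
  proof -
    from that have X: "X \<in> carrier_mat n n" "Y \<in> carrier_mat n n"
      and e: "transpose_mat X * B + B * X = 0\<^sub>m n n" "transpose_mat Y * B + B * Y = 0\<^sub>m n n" by (auto simp: sol_def)
    have P: "p * q \<in> carrier_mat n n" if "p \<in> carrier_mat n n" "q \<in> carrier_mat n n"
      for p q :: "complex mat"
      using that by simp
    have T: "transpose_mat X \<in> carrier_mat n n" "transpose_mat Y \<in> carrier_mat n n" using X by auto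
    have adj: "transpose_mat Z * B = - (B * Z)"
      if Z: "Z \<in> carrier_mat n n" "transpose_mat Z * B + B * Z = 0\<^sub>m n n" for Z
    proof (rule eq_matI)
      fix i j assume "i < dim_row (- (B * Z))" "j < dim_col (- (B * Z))"
      then have ij: "i < n" "j < n" using B Z(1) by auto
      have "(transpose_mat Z * B + B * Z) $$ (i, j) = 0" using Z(2) ij by simp
      moreover have "(transpose_mat Z * B + B * Z) $$ (i, j)
          = (transpose_mat Z * B) $$ (i, j) + (B * Z) $$ (i, j)"
        using ij B Z(1) by (intro index_add_mat(1)) auto
      moreover have "(- (B * Z)) $$ (i, j) = - ((B * Z) $$ (i, j))"
        using ij B Z(1) by (intro index_uminus_mat(1)) auto
      ultimately show "(transpose_mat Z * B) $$ (i, j) = (- (B * Z)) $$ (i, j)"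
        by (metis eq_neg_iff_add_eq_0)
    qed (use Z B in auto)
    have swap: "transpose_mat V * (transpose_mat W * B) = B * V * W"
      if V: "V \<in> carrier_mat n n" "transpose_mat V * B + B * V = 0\<^sub>m n n"
        and W: "W \<in> carrier_mat n n" "transpose_mat W * B + B * W = 0\<^sub>m n n" for V W
    proof -
      have V': "transpose_mat V \<in> carrier_mat n n" using V(1) by simp
      have "transpose_mat V * (transpose_mat W * B) = - (transpose_mat V * (B * W))"
        unfolding adj[OF W] using V' B W(1) by (intro uminus_mult_right_mat) auto
      also have "\<dots> = - (transpose_mat V * B * W)" by (simp only: assoc_mult_mat[OF V' B W(1)])
      also have "\<dots> = B * V * W"
        unfolding adj[OF V] using B V(1) W(1) by (subst uminus_mult_left_mat) auto
      finally show ?thesis .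
    qed
    have "transpose_mat (X * Y - Y * X)
        = transpose_mat Y * transpose_mat X - transpose_mat X * transpose_mat Y"
      by (simp only: transpose_minus[OF P[OF X] P[OF X(2,1)]] transpose_mult[OF X]
          transpose_mult[OF X(2,1)])
    then have "transpose_mat (X * Y - Y * X) * B = B * Y * X - B * X * Y"
      by (simp only: minus_mult_distrib_mat[OF P[OF T(2,1)] P[OF T] B] assoc_mult_mat[OF T(2,1) B]
          assoc_mult_mat[OF T B] swap[OF X(1) e(1) X(2) e(2)] swap[OF X(2) e(2) X(1) e(1)])
    moreover have "B * (X * Y - Y * X) = B * X * Y - B * Y * X"
      by (simp only: mult_minus_distrib_mat[OF B P[OF X] P[OF X(2,1)]] assoc_mult_mat[OF B X]
          assoc_mult_mat[OF B X(2,1)])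
    moreover have "(B * Y * X - B * X * Y) + (B * X * Y - B * Y * X) = 0\<^sub>m n n"
      using B X by (intro eq_matI) (simp_all del: index_mult_mat(1))
    ultimately have "transpose_mat (X * Y - Y * X) * B + B * (X * Y - Y * X) = 0\<^sub>m n n"
      by (simp only:)
    then show "bracket (gl n) X Y \<in> carrier (sol n B)" using P X by (simp add: sol_def minus_carrier_mat)
  qed
  show ?thesis
    using lie_algebra_axioms sm closed
    by (intro lie_subalgebra.intro subspace.intro lie_subalgebra_axioms.intro vectorspace_axioms)
qed

corollary sol_lie_algebra:
  assumes "B \<in> carrier_mat n n"
  shows "lie_algebra CC (sol n B)"
  using lie_subalgebra_is_lie[OF sol_lie_subalgebra[OF assms]] by (simp add: sol_def)

text \<open>\<open>unit_mat n i j\<close> is the matrix unit with the 1-based indices of the literature, whereas the entries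
  of a \<^typ>\<open>complex mat\<close> are indexed from 0. It is the zero matrix if \<open>i > n\<close> or \<open>j > n\<close>.\<close>

definition unit_mat :: "nat \<Rightarrow> nat \<Rightarrow> nat \<Rightarrow> complex mat" where
  "unit_mat n i j = mat n n (\<lambda>(r, s). if r + 1 = i \<and> s + 1 = j then 1 else 0)"

definition shift_mat :: "nat \<Rightarrow> complex mat" where
  "shift_mat n = mat n n (\<lambda>(r, s). if s = r + 1 then 1 else 0)"

abbreviation sol_A2 :: "nat \<Rightarrow> (complex, complex mat) lie" where
  "sol_A2 n \<equiv> sol n (shift_mat n ^\<^sub>m 2)"

text \<open>The range \<open>0 \<le> l \<le> (n - 2 - 4 k) / 4\<close>, written without truncated subtraction, so that it is
  empty for \<open>k > (n - 2) / 4\<close>.\<close>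

definition range_l :: "nat \<Rightarrow> nat \<Rightarrow> nat set" where
  "range_l n k = {l. 4 * l + 4 * k + 2 \<le> n}"

definition el_h1 :: "nat \<Rightarrow> complex mat" where
  "el_h1 n = (\<Oplus>\<^bsub>gl n\<^esub>l\<in>range_l n 0. unit_mat n (1 + 4*l) (1 + 4*l) - unit_mat n (3 + 4*l) (3 + 4*l))"

definition el_h2 :: "nat \<Rightarrow> complex mat" where
  "el_h2 n = (\<Oplus>\<^bsub>gl n\<^esub>l\<in>range_l n 0. unit_mat n (2 + 4*l) (2 + 4*l) - unit_mat n (4 + 4*l) (4 + 4*l))"

definition el_e :: "nat \<Rightarrow> complex mat" where
  "el_e n = (\<Oplus>\<^bsub>gl n\<^esub>l\<in>range_l n 0. unit_mat n (1 + 4*l) (2 + 4*l) - unit_mat n (4 + 4*l) (3 + 4*l))"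

definition el_f :: "nat \<Rightarrow> complex mat" where
  "el_f n = (\<Oplus>\<^bsub>gl n\<^esub>l\<in>range_l n 0. unit_mat n (2 + 4*l) (1 + 4*l) - unit_mat n (3 + 4*l) (4 + 4*l))"

text \<open>In the following four definitions only \<open>k \<ge> 1\<close> is meaningful, so that the column
  \<open>-1 + 4 l + 4 k\<close> is positive and the subtraction below does not truncate.\<close>

definition el_a :: "nat \<Rightarrow> nat \<Rightarrow> complex mat" where
  "el_a n k = (\<Oplus>\<^bsub>gl n\<^esub>l\<in>range_l n k.
     unit_mat n (1 + 4*l) (4*l + 4*k - 1) - unit_mat n (1 + 4*l + 4*k) (3 + 4*l))"

definition el_b :: "nat \<Rightarrow> nat \<Rightarrow> complex mat" where
  "el_b n k = (\<Oplus>\<^bsub>gl n\<^esub>l\<in>range_l n k.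
     unit_mat n (1 + 4*l) (4*l + 4*k) - unit_mat n (2 + 4*l + 4*k) (3 + 4*l))"

definition el_c :: "nat \<Rightarrow> nat \<Rightarrow> complex mat" where
  "el_c n k = (\<Oplus>\<^bsub>gl n\<^esub>l\<in>range_l n k.
     unit_mat n (2 + 4*l) (4*l + 4*k - 1) - unit_mat n (1 + 4*l + 4*k) (4 + 4*l))"

definition el_d :: "nat \<Rightarrow> nat \<Rightarrow> complex mat" where
  "el_d n k = (\<Oplus>\<^bsub>gl n\<^esub>l\<in>range_l n k.
     unit_mat n (2 + 4*l) (4*l + 4*k) - unit_mat n (2 + 4*l + 4*k) (4 + 4*l))"

definition ideal_b :: "nat \<Rightarrow> nat \<Rightarrow> complex mat set" where
  "ideal_b n l = LinearCombinations.module.span CC (sol_A2 n) {el_a n l, el_b n l, el_c n l, el_d n l}"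

definition ideal_a :: "nat \<Rightarrow> nat \<Rightarrow> complex mat set" where
  "ideal_a n k = family_sum (sol_A2 n) {k..(n - 2) div 4} (ideal_b n)"

end

theory Submission
  imports Defs
begin

text \<open>Group the indices in pairs and view matrices as block matrices with blocks of size 2; since \<open>n\<close> is
  congruent to 2 modulo 4, the number of pairs is odd, and both the first and the last pair (counted from 0)
  are even. The equation defining \<open>sol\<close> says that the block at \<open>(p + 1, q + 1)\<close> is minus the transpose
  of the block at \<open>(q, p)\<close>, and that the first and last block columns vanish off the diagonal. Hence every
  element is the sum of a block diagonal matrix \<open>g(M) = diag(M, - M\<^sup>t, M, \<dots>)\<close> and of a matrix supported on
  even block rows and odd block columns. Two matrices of the second kind have product 0, so \<open>\<aa>\<close>
  is abelian. With \<open>x\<^sub>k(W)\<close> the general element of \<open>\<bb>\<^sub>k\<close>, one has \<open>[g(M), x\<^sub>k(W)] = x\<^sub>k(M W + W M\<^sup>t)\<close>, so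
  \<open>\<bb>\<^sub>k\<close> is an ideal, and \<open>g\<close> is an isomorphism of \<open>gl\<^sub>2 = sl\<^sub>2 \<oplus> \<complex>\<close> onto the algebra generated by
  \<open>h\<^sub>1, h\<^sub>2, e, f\<close>.\<close>

section \<open>Lie algebras\<close>

lemma (in lie_algebra) lie_idealI:
  assumes "I \<subseteq> carrier L" "\<zero>\<^bsub>L\<^esub> \<in> I"
    and "\<And>x y. x \<in> I \<Longrightarrow> y \<in> I \<Longrightarrow> x \<oplus>\<^bsub>L\<^esub> y \<in> I"
    and "\<And>c x. c \<in> carrier K \<Longrightarrow> x \<in> I \<Longrightarrow> c \<odot>\<^bsub>L\<^esub> x \<in> I"
    and "\<And>x y. x \<in> carrier L \<Longrightarrow> y \<in> I \<Longrightarrow> bracket L x y \<in> I"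
  shows "lie_ideal K I L"
  using assms lie_algebra_axioms vectorspace_axioms module_axioms
  by (auto intro!: lie_ideal.intro subspace.intro submodule.intro lie_ideal_axioms.intro)

lemma (in lie_algebra) lie_subalgebraI:
  assumes "H \<subseteq> carrier L" "\<zero>\<^bsub>L\<^esub> \<in> H"
    and "\<And>x y. x \<in> H \<Longrightarrow> y \<in> H \<Longrightarrow> x \<oplus>\<^bsub>L\<^esub> y \<in> H"
    and "\<And>c x. c \<in> carrier K \<Longrightarrow> x \<in> H \<Longrightarrow> c \<odot>\<^bsub>L\<^esub> x \<in> H"
    and "\<And>x y. x \<in> H \<Longrightarrow> y \<in> H \<Longrightarrow> bracket L x y \<in> H"
  shows "lie_subalgebra K H L"
  using assms lie_algebra_axioms vectorspace_axioms module_axioms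
  by (auto intro!: lie_subalgebra.intro subspace.intro submodule.intro lie_subalgebra_axioms.intro)

lemma (in lie_algebra) bracket_zero_right:
  assumes "x \<in> carrier L" shows "bracket L x \<zero>\<^bsub>L\<^esub> = \<zero>\<^bsub>L\<^esub>"
  using bracket_smult_right[OF R.zero_closed assms M.zero_closed] bracket_closed[OF assms M.zero_closed]
  by simp

lemma (in lie_algebra) bracket_finsum_right:
  assumes "finite A" "x \<in> carrier L" "f \<in> A \<rightarrow> carrier L"
  shows "bracket L x (finsum L f A) = finsum L (\<lambda>i. bracket L x (f i)) A"
  using assms(1,3)
proof (induction A rule: finite_induct)
  case empty
  then show ?case using bracket_zero_right[OF assms(2)] by simp
next
  case (insert a A)
  then have "(\<lambda>i. bracket L x (f i)) \<in> insert a A \<rightarrow> carrier L"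
    using bracket_closed[OF assms(2)] by blast
  with insert show ?case
    by (simp add: M.finsum_insert M.finsum_closed Pi_def bracket_add_right[OF assms(2)])
qed

text \<open>Every closure condition is linear in the element of the sum, hence can be checked in
  each summand; for the bracket this is \<open>bracket_finsum_right\<close>.\<close>

lemma (in lie_algebra) family_sum_lie_ideal:
  assumes fin: "finite A" and ideal: "\<And>i. i \<in> A \<Longrightarrow> lie_ideal K (W i) L"
  shows "lie_ideal K (family_sum L A W) L"
proof -
  have sm: "submodule K (W i) L" if "i \<in> A" for i
    using ideal[OF that] by (simp add: lie_ideal_def subspace_def)
  have carr: "v \<in> A \<rightarrow> carrier L" if "v \<in> Pi A W" for v
    using that sm by (fastforce simp: submodule_def)
  show ?thesis
  proof (rule lie_idealI)
    show "family_sum L A W \<subseteq> carrier L"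
      using carr by (auto simp: family_sum_def intro: M.finsum_closed)
    have "(\<lambda>_. \<zero>\<^bsub>L\<^esub>) \<in> Pi A W" using sm by (auto simp: submodule_def)
    moreover have "finsum L (\<lambda>_. \<zero>\<^bsub>L\<^esub>) A = \<zero>\<^bsub>L\<^esub>" by (rule M.finsum_zero)
    ultimately show "\<zero>\<^bsub>L\<^esub> \<in> family_sum L A W" unfolding family_sum_def by force
  next
    fix x y assume "x \<in> family_sum L A W" "y \<in> family_sum L A W"
    then obtain v w where v: "v \<in> Pi A W" "x = finsum L v A" and w: "w \<in> Pi A W" "y = finsum L w A"
      by (auto simp: family_sum_def)
    have "x \<oplus>\<^bsub>L\<^esub> y = finsum L (\<lambda>i. v i \<oplus>\<^bsub>L\<^esub> w i) A"
      using v w carr by (simp add: M.finsum_addf)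
    moreover have "(\<lambda>i. v i \<oplus>\<^bsub>L\<^esub> w i) \<in> Pi A W"
      using v w submodule.m_closed[OF sm] by (auto simp: Pi_iff)
    ultimately show "x \<oplus>\<^bsub>L\<^esub> y \<in> family_sum L A W" unfolding family_sum_def by blast
  next
    fix c x assume c: "c \<in> carrier K" and "x \<in> family_sum L A W"
    then obtain v where v: "v \<in> Pi A W" "x = finsum L v A"
      by (auto simp: family_sum_def)
    have "c \<odot>\<^bsub>L\<^esub> x = finsum L (\<lambda>i. c \<odot>\<^bsub>L\<^esub> v i) A"
      using finsum_smult_ldistr[OF fin c carr[OF v(1)]] v(2) by simp
    moreover have "(\<lambda>i. c \<odot>\<^bsub>L\<^esub> v i) \<in> Pi A W"
      using v c submodule.smult_closed[OF sm] by (auto simp: Pi_iff)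
    ultimately show "c \<odot>\<^bsub>L\<^esub> x \<in> family_sum L A W" unfolding family_sum_def by blast
  next
    fix x y assume x: "x \<in> carrier L" and "y \<in> family_sum L A W"
    then obtain v where v: "v \<in> Pi A W" "y = finsum L v A"
      by (auto simp: family_sum_def)
    have "bracket L x y = finsum L (\<lambda>i. bracket L x (v i)) A"
      using bracket_finsum_right[OF fin x carr[OF v(1)]] v(2) by simp
    moreover have "(\<lambda>i. bracket L x (v i)) \<in> Pi A W"
      using v(1) lie_ideal.ideal_closed[OF ideal x] by blast
    ultimately show "bracket L x y \<in> family_sum L A W" unfolding family_sum_def by blast
  qed
qed

text \<open>Turns the vanishing of all brackets into the vanishing of a
  \<open>bracket_space\<close>; this serves both nilpotency and the inclusion for the ideals
  \<open>ideal_a\<close>.\<close>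

lemma (in vectorspace) span_subset_zero:
  assumes "S \<subseteq> {\<zero>\<^bsub>V\<^esub>}"
  shows "span S = {\<zero>\<^bsub>V\<^esub>}"
proof
  have "submodule K {\<zero>\<^bsub>V\<^esub>} V"
    using module_axioms by (auto intro!: submodule.intro)
  then show "span S \<subseteq> {\<zero>\<^bsub>V\<^esub>}" using assms by (rule span_is_subset[rotated])
  have "S \<subseteq> carrier V" using assms by auto
  then show "{\<zero>\<^bsub>V\<^esub>} \<subseteq> span S" using span_is_submodule[of S] by (auto simp: submodule_def)
qed

lemma lie_nilpotent_if_abelian:
  assumes "lie_algebra K L" "lie_abelian L"
  shows "lie_nilpotent K L"
proof -
  interpret lie_algebra K L by fact
  \<comment> \<open>The series starts with the whole algebra at index 0, so index 1 is the span of
    all brackets.\<close>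
  have "lower_central_series K L 1 = {\<zero>\<^bsub>L\<^esub>}"
    unfolding One_nat_def lower_central_series.simps bracket_space_def
    by (rule span_subset_zero) (use assms(2) in \<open>auto simp: lie_abelian_def\<close>)
  then show ?thesis unfolding lie_nilpotent_def by blast
qed

lemma lie_ideal_is_lie:
  assumes "lie_ideal K I L" shows "lie_algebra K (L\<lparr>carrier := I\<rparr>)"
proof -
  interpret lie_ideal K I L by fact
  have "I \<subseteq> carrier L" using submod by (simp add: submodule_def)
  then have "lie_subalgebra K I L"
    using lie_algebra_axioms subspace_axioms ideal_closed
    by (auto intro!: lie_subalgebra.intro lie_subalgebra_axioms.intro)
  then show ?thesis by (rule lie_subalgebra_is_lie)
qed

section \<open>The target of the isomorphism: direct sums, the line \<open>lie_C\<close> and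
  \<open>sl n\<close>\<close>

lemma lie_algebra_direct_sum:
  assumes "lie_algebra K L" "lie_algebra K M"
  shows "lie_algebra K (lie_direct_sum L M)"
proof -
  interpret L: lie_algebra K L by fact
  interpret M: lie_algebra K M by fact
  note simps = lie_direct_sum_def module.defs lie.defs direct_sum_def
  have "abelian_group (lie_direct_sum L M)"
  proof (rule abelian_groupI)
    fix x assume "x \<in> carrier (lie_direct_sum L M)"
    then show "\<exists>y\<in>carrier (lie_direct_sum L M). y \<oplus>\<^bsub>lie_direct_sum L M\<^esub> x = \<zero>\<^bsub>lie_direct_sum L M\<^esub>"
      by (intro bexI[of _ "(\<ominus>\<^bsub>L\<^esub> fst x, \<ominus>\<^bsub>M\<^esub> snd x)"]) (auto simp: simps L.M.l_neg M.M.l_neg)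
  qed (auto simp: simps L.M.a_ac M.M.a_ac)
  then have "vectorspace K (lie_direct_sum L M)"
    unfolding vectorspace_def Module.module_def Module.module_axioms_def
    using L.field_axioms L.R.is_cring
    by (auto simp: simps L.smult_l_distr M.smult_l_distr L.smult_r_distr M.smult_r_distr
        L.smult_assoc1 M.smult_assoc1)
  then show ?thesis
    by (rule lie_algebra.intro, unfold_locales)
      (auto simp: simps L.bracket_closed M.bracket_closed
        L.bracket_add_left M.bracket_add_left L.bracket_add_right M.bracket_add_right
        L.bracket_smult_left M.bracket_smult_left L.bracket_smult_right M.bracket_smult_right
        L.bracket_self M.bracket_self L.jacobi M.jacobi)
qed

lemma lie_C_lie_algebra: "lie_algebra CC lie_C"
proof -
  have "abelian_group lie_C"
    by (rule abelian_groupI) (auto simp: lie_C_def ac_simps intro: exI[of _ "- _"] add.left_inverse)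
  then have "vectorspace CC lie_C"
    unfolding vectorspace_def Module.module_def Module.module_axioms_def
    using class_field class_cring.is_cring by (auto simp: lie_C_def algebra_simps)
  then show ?thesis
    by (rule lie_algebra.intro, unfold_locales) (auto simp: lie_C_def)
qed

text \<open>This is tr(XY) = tr(YX); it makes commutators traceless, so that \<open>sl n\<close> is
  closed under the bracket.\<close>

lemma sum_diag_mult_commute:
  fixes X Y :: "'a :: comm_semiring_0 mat"
  assumes "X \<in> carrier_mat n n" "Y \<in> carrier_mat n n"
  shows "(\<Sum>i<n. (X * Y) $$ (i, i)) = (\<Sum>i<n. (Y * X) $$ (i, i))"
proof -
  have "(\<Sum>i<n. (X * Y) $$ (i, i)) = (\<Sum>i<n. \<Sum>j<n. X $$ (i, j) * Y $$ (j, i))"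
    using assms by (auto simp: scalar_prod_def lessThan_atLeast0 intro!: sum.cong)
  also have "\<dots> = (\<Sum>i<n. \<Sum>j<n. Y $$ (i, j) * X $$ (j, i))"
    by (subst sum.swap) (simp add: mult.commute)
  also have "\<dots> = (\<Sum>i<n. (Y * X) $$ (i, i))"
    using assms by (auto simp: scalar_prod_def lessThan_atLeast0 intro!: sum.cong)
  finally show ?thesis .
qed

lemma sl_lie_algebra: "lie_algebra CC (sl n)"
proof -
  interpret lie_algebra CC "gl n" by (rule gl_lie_algebra)
  have "lie_subalgebra CC {X \<in> carrier_mat n n. (\<Sum>i<n. X $$ (i, i)) = 0} (gl n)"
  proof (rule lie_subalgebraI)
    fix X Y :: "complex mat"
    assume "X \<in> {X \<in> carrier_mat n n. (\<Sum>i<n. X $$ (i, i)) = 0}"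
      "Y \<in> {X \<in> carrier_mat n n. (\<Sum>i<n. X $$ (i, i)) = 0}"
    then have X: "X \<in> carrier_mat n n" and Y: "Y \<in> carrier_mat n n" by auto
    have "(\<Sum>i<n. (X * Y - Y * X) $$ (i, i)) = (\<Sum>i<n. (X * Y) $$ (i, i) - (Y * X) $$ (i, i))"
      using X Y by (intro sum.cong) auto
    also have "\<dots> = 0" using sum_diag_mult_commute[OF X Y] by (simp add: sum_subtractf)
    finally show "bracket (gl n) X Y \<in> {X \<in> carrier_mat n n. (\<Sum>i<n. X $$ (i, i)) = 0}"
      using X Y by (auto simp del: index_minus_mat(1) index_mult_mat(1))
  qed (auto simp: sum.distrib simp flip: sum_distrib_left)
  then show ?thesis unfolding sl_def by (rule lie_subalgebra_is_lie)
qed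

section \<open>The defining equations\<close>

lemma sol_simps:
  "carrier (sol n B) = {X \<in> carrier_mat n n. transpose_mat X * B + B * X = 0\<^sub>m n n}"
  "zero (sol n B) = 0\<^sub>m n n" "add (sol n B) = (+)"
  "smult (sol n B) = (\<cdot>\<^sub>m)" "bracket (sol n B) = (\<lambda>X Y. X * Y - Y * X)"
  by (simp_all add: sol_def)

lemma shift_mat_square:
  "shift_mat n ^\<^sub>m 2 = mat n n (\<lambda>(r, s). if s = r + 2 then 1 else 0)"
proof (rule eq_matI)
  fix r s assume "r < dim_row (mat n n (\<lambda>(r, s). if s = r + 2 then 1 else (0 :: complex)))"
    "s < dim_col (mat n n (\<lambda>(r, s). if s = r + 2 then 1 else (0 :: complex)))"
  then have rs: "r < n" "s < n" by auto
  have "(shift_mat n ^\<^sub>m 2) $$ (r, s)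
      = (\<Sum>t = 0..<n. (if t = r + 1 then 1 else 0) * (if s = t + 1 then 1 else 0))"
    using rs by (simp add: numeral_2_eq_2 shift_mat_def scalar_prod_def)
  \<comment> \<open>Only t = r + 1 can contribute, and if s = r + 2 < n, then this t lies in the
    range of summation.\<close>
  also have "\<dots> = (\<Sum>t = 0..<n. if t = r + 1 then if s = r + 2 then 1 else 0 else 0)"
    by (intro sum.cong) auto
  also have "\<dots> = (if s = r + 2 then 1 else 0)" using rs by auto
  finally show "(shift_mat n ^\<^sub>m 2) $$ (r, s)
      = mat n n (\<lambda>(r, s). if s = r + 2 then 1 else 0) $$ (r, s)" using rs by simp
qed (simp_all add: numeral_2_eq_2 shift_mat_def)

text \<open>Right multiplication by the squared shift moves columns two places to the right, left
  multiplication moves rows two places up. The conditionals record the zeros that enter at the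
  border.\<close>

lemma sol_A2_iff:
  "X \<in> carrier (sol_A2 n) \<longleftrightarrow> X \<in> carrier_mat n n \<and>
    (\<forall>i<n. \<forall>j<n. (if 2 \<le> j then X $$ (j - 2, i) else 0) + (if i + 2 < n then X $$ (i + 2, j) else 0) = 0)"
proof -
  let ?B = "mat n n (\<lambda>(r, s). if s = r + 2 then 1 else 0) :: complex mat"
  have entry: "(transpose_mat X * ?B + ?B * X) $$ (i, j)
      = (if 2 \<le> j then X $$ (j - 2, i) else 0) + (if i + 2 < n then X $$ (i + 2, j) else 0)"
    if X: "X \<in> carrier_mat n n" and ij: "i < n" "j < n" for i j
  proof -
    have "(transpose_mat X * ?B) $$ (i, j) = (\<Sum>t = 0..<n. X $$ (t, i) * (if j = t + 2 then 1 else 0))"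
      using X ij by (simp add: scalar_prod_def)
    also have "\<dots> = (\<Sum>t = 0..<n. if t = j - 2 then if 2 \<le> j then X $$ (j - 2, i) else 0 else 0)"
      by (intro sum.cong) auto
    also have "\<dots> = (if 2 \<le> j then X $$ (j - 2, i) else 0)" using ij by auto
    finally have 1: "(transpose_mat X * ?B) $$ (i, j) = (if 2 \<le> j then X $$ (j - 2, i) else 0)" .
    have "(?B * X) $$ (i, j) = (\<Sum>t = 0..<n. (if t = i + 2 then 1 else 0) * X $$ (t, j))"
      using X ij by (simp add: scalar_prod_def)
    also have "\<dots> = (\<Sum>t = 0..<n. if t = i + 2 then X $$ (i + 2, j) else 0)"
      by (intro sum.cong) auto
    also have "\<dots> = (if i + 2 < n then X $$ (i + 2, j) else 0)" by simp
    finally have "(?B * X) $$ (i, j) = (if i + 2 < n then X $$ (i + 2, j) else 0)" .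
    with 1 show ?thesis using X ij by (simp del: index_mult_mat(1))
  qed
  have zero_iff: "Z = 0\<^sub>m n n \<longleftrightarrow> (\<forall>i<n. \<forall>j<n. Z $$ (i, j) = 0)"
    if "Z \<in> carrier_mat n n" for Z :: "complex mat"
    using that by (auto intro!: eq_matI)
  have carr: "transpose_mat X * ?B + ?B * X \<in> carrier_mat n n" if "X \<in> carrier_mat n n"
    using that by auto
  have "transpose_mat X * ?B + ?B * X = 0\<^sub>m n n \<longleftrightarrow>
      (\<forall>i<n. \<forall>j<n. (if 2 \<le> j then X $$ (j - 2, i) else 0) + (if i + 2 < n then X $$ (i + 2, j) else 0) = 0)"
    if "X \<in> carrier_mat n n"
    unfolding zero_iff[OF carr[OF that]] by (intro all_cong1 imp_cong refl) (simp only: entry[OF that])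
  then show ?thesis
    unfolding sol_simps shift_mat_square by blast
qed

lemma sol_A2_lie_algebra: "lie_algebra CC (sol_A2 n)"
  by (rule sol_lie_algebra) (simp add: shift_mat_square)

lemma sol_A2_eq:
  assumes "X \<in> carrier (sol_A2 n)" "i < n" "j < n"
  shows "(if 2 \<le> j then X $$ (j - 2, i) else 0) + (if i + 2 < n then X $$ (i + 2, j) else 0) = 0"
  using assms(1) unfolding sol_A2_iff using assms(2,3) by blast

text \<open>The equation at position (r - 2, s). Together with \<open>sol_A2_push\<close>, which is
  the equation at (s, r + 2), it lets an entry be reflected and moved by two places in either
  direction.\<close>

lemma sol_A2_pull:
  assumes "X \<in> carrier (sol_A2 n)" "2 \<le> r" "r < n" "s < n"
  shows "X $$ (r, s) = (if 2 \<le> s then - X $$ (s - 2, r - 2) else 0)"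
proof -
  have "r - 2 < n" and r: "r - 2 + 2 = r" using assms by auto
  from sol_A2_eq[OF assms(1) this(1) assms(4)]
  show ?thesis unfolding r using assms(3) by (cases "2 \<le> s") (simp_all add: eq_neg_iff_add_eq_0 add.commute)
qed

lemma sol_A2_push:
  assumes "X \<in> carrier (sol_A2 n)" "r + 2 < n" "s < n"
  shows "X $$ (r, s) = (if s + 2 < n then - X $$ (s + 2, r + 2) else 0)"
  using sol_A2_eq[OF assms(1,3,2)] by (cases "s + 2 < n") (simp_all add: eq_neg_iff_add_eq_0)

section \<open>Block matrices\<close>

text \<open>Pair \<open>p\<close> consists of the 0-based indices \<open>2 p\<close> and \<open>2 p + 1\<close>, and a 2 by 2 matrix is given by its
  entries \<open>M u v\<close> with \<open>u, v < 2\<close>. With the notation \<open>g(M)\<close>, \<open>x\<^sub>k(W)\<close> of the introduction, \<open>levi_mat n M\<close> is \<open>g(M)\<close> and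
  \<open>nil_mat n k W = W\<^sub>0\<^sub>0 a\<^sub>k + W\<^sub>0\<^sub>1 b\<^sub>k + W\<^sub>1\<^sub>0 c\<^sub>k + W\<^sub>1\<^sub>1 d\<^sub>k\<close> is \<open>x\<^sub>k(W)\<close>; the truncated subtraction
  in \<open>nil_mat\<close> is harmless for \<open>k \<ge> 1\<close>.\<close>

definition levi_mat :: "nat \<Rightarrow> (nat \<Rightarrow> nat \<Rightarrow> complex) \<Rightarrow> complex mat" where
  "levi_mat n M = mat n n (\<lambda>(r, s). if r div 2 = s div 2
     then if even (r div 2) then M (r mod 2) (s mod 2) else - M (s mod 2) (r mod 2) else 0)"

definition nil_mat :: "nat \<Rightarrow> nat \<Rightarrow> (nat \<Rightarrow> nat \<Rightarrow> complex) \<Rightarrow> complex mat" where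
  "nil_mat n k W = mat n n (\<lambda>(r, s). if even (r div 2)
     then (if s div 2 = r div 2 + 2 * k - 1 then W (r mod 2) (s mod 2) else 0)
        - (if r div 2 = s div 2 + 2 * k - 1 then W (s mod 2) (r mod 2) else 0) else 0)"

text \<open>The second kind of matrix in the introduction. If the even pairs are listed before the
  odd ones, its support is a single off-diagonal corner.\<close>

definition corner_mat :: "nat \<Rightarrow> complex mat \<Rightarrow> bool" where
  "corner_mat n Z \<longleftrightarrow> Z \<in> carrier_mat n n \<and>
     (\<forall>r<n. \<forall>s<n. odd (r div 2) \<or> even (s div 2) \<longrightarrow> Z $$ (r, s) = 0)"

lemma levi_mat_carrier [simp]: "levi_mat n M \<in> carrier_mat n n"
  by (simp add: levi_mat_def)

lemma nil_mat_carrier [simp]: "nil_mat n k W \<in> carrier_mat n n"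
  by (simp add: nil_mat_def)

lemma levi_mat_dim [simp]: "dim_row (levi_mat n M) = n" "dim_col (levi_mat n M) = n"
  by (simp_all add: levi_mat_def)

lemma nil_mat_dim [simp]: "dim_row (nil_mat n k W) = n" "dim_col (nil_mat n k W) = n"
  by (simp_all add: nil_mat_def)

lemma levi_mat_index:
  assumes "r < n" "s < n"
  shows "levi_mat n M $$ (r, s) = (if r div 2 = s div 2
     then if even (r div 2) then M (r mod 2) (s mod 2) else - M (s mod 2) (r mod 2) else 0)"
  using assms by (simp add: levi_mat_def)

lemma nil_mat_index:
  assumes "r < n" "s < n"
  shows "nil_mat n k W $$ (r, s) = (if even (r div 2)
     then (if s div 2 = r div 2 + 2 * k - 1 then W (r mod 2) (s mod 2) else 0)
        - (if r div 2 = s div 2 + 2 * k - 1 then W (s mod 2) (r mod 2) else 0) else 0)"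
  using assms by (simp add: nil_mat_def)

text \<open>For k \<ge> 1 the block distance 2k - 1 is odd, so row and column blocks of a nonzero
  block have opposite parity; the definition already requires the row block to be even.\<close>

lemma corner_nil_mat:
  assumes "1 \<le> k"
  shows "corner_mat n (nil_mat n k W)"
proof -
  have "q \<noteq> p + 2 * k - 1 \<and> p \<noteq> q + 2 * k - 1" if "even p" "even q" for p q :: nat
    using that assms by presburger
  then show ?thesis by (simp add: corner_mat_def nil_mat_index)
qed

text \<open>Each inner index t lies in an even or in an odd pair: in the first case the column t of
  X vanishes, in the second the row t of Y.\<close>

lemma corner_mult_corner:
  assumes "corner_mat n X" "corner_mat n Y"
  shows "X * Y = 0\<^sub>m n n"
proof (rule eq_matI)
  have carr: "X \<in> carrier_mat n n" "Y \<in> carrier_mat n n"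
    using assms by (simp_all add: corner_mat_def)
  fix r s assume "r < dim_row (0\<^sub>m n n :: complex mat)" "s < dim_col (0\<^sub>m n n :: complex mat)"
  then have rs: "r < n" "s < n" by auto
  then have "(X * Y) $$ (r, s) = (\<Sum>t = 0..<n. X $$ (r, t) * Y $$ (t, s))"
    using carr by (simp add: scalar_prod_def)
  also have "\<dots> = 0"
  proof (rule sum.neutral, rule ballI)
    fix t assume "t \<in> {0..<n}"
    then have "X $$ (r, t) = 0 \<or> Y $$ (t, s) = 0"
      using assms rs unfolding corner_mat_def atLeastLessThan_iff by blast
    then show "X $$ (r, t) * Y $$ (t, s) = 0" by auto
  qed
  finally show "(X * Y) $$ (r, s) = 0\<^sub>m n n $$ (r, s)" using rs by simp
qed (use assms in \<open>auto simp: corner_mat_def\<close>)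

text \<open>Collapses a product with a block diagonal factor to two terms. Evenness of n keeps both
  members of the pair of r below n.\<close>

lemma sum_pair:
  assumes "even n" "r < n" "\<And>t. t < n \<Longrightarrow> t div 2 \<noteq> r div 2 \<Longrightarrow> f t = (0 :: 'a :: comm_monoid_add)"
  shows "sum f {0..<n} = f (2 * (r div 2)) + f (Suc (2 * (r div 2)))"
proof -
  have "Suc (2 * (r div 2)) < n" using assms(1,2) by presburger
  moreover have "t = 2 * (r div 2) \<or> t = Suc (2 * (r div 2))" if "t div 2 = r div 2" for t
    using that by presburger
  moreover have "f t = 0" if "t \<in> {0..<n} - {2 * (r div 2), Suc (2 * (r div 2))}" for t
    using that calculation(2)[of t] assms(3)[of t] by (cases "t div 2 = r div 2") auto
  ultimately have "sum f {0..<n} = sum f {2 * (r div 2), Suc (2 * (r div 2))}"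
    by (intro sum.mono_neutral_right) simp_all
  then show ?thesis by simp
qed

section \<open>Products and commutators with block diagonal matrices\<close>

lemma levi_mult_index:
  assumes "even n" "A \<in> carrier_mat n n" "r < n" "s < n"
  shows "(levi_mat n M * A) $$ (r, s) = (if even (r div 2)
    then M (r mod 2) 0 * A $$ (2 * (r div 2), s) + M (r mod 2) 1 * A $$ (Suc (2 * (r div 2)), s)
    else - M 0 (r mod 2) * A $$ (2 * (r div 2), s) - M 1 (r mod 2) * A $$ (Suc (2 * (r div 2)), s))"
proof -
  have "Suc (2 * (r div 2)) < n" using assms(1,3) by presburger
  moreover have "(levi_mat n M * A) $$ (r, s) = (\<Sum>t = 0..<n. levi_mat n M $$ (r, t) * A $$ (t, s))"
    using assms by (simp add: scalar_prod_def)
  moreover have "\<dots> = levi_mat n M $$ (r, 2 * (r div 2)) * A $$ (2 * (r div 2), s)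
      + levi_mat n M $$ (r, Suc (2 * (r div 2))) * A $$ (Suc (2 * (r div 2)), s)"
    using assms by (intro sum_pair) (auto simp: levi_mat_index)
  ultimately show ?thesis using assms by (simp add: levi_mat_index)
qed

lemma mult_levi_index:
  assumes "even n" "A \<in> carrier_mat n n" "r < n" "s < n"
  shows "(A * levi_mat n M) $$ (r, s) = (if even (s div 2)
    then A $$ (r, 2 * (s div 2)) * M 0 (s mod 2) + A $$ (r, Suc (2 * (s div 2))) * M 1 (s mod 2)
    else - A $$ (r, 2 * (s div 2)) * M (s mod 2) 0 - A $$ (r, Suc (2 * (s div 2))) * M (s mod 2) 1)"
proof -
  have "Suc (2 * (s div 2)) < n" using assms(1,4) by presburger
  moreover have "(A * levi_mat n M) $$ (r, s) = (\<Sum>t = 0..<n. A $$ (r, t) * levi_mat n M $$ (t, s))"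
    using assms by (simp add: scalar_prod_def)
  moreover have "\<dots> = A $$ (r, 2 * (s div 2)) * levi_mat n M $$ (2 * (s div 2), s)
      + A $$ (r, Suc (2 * (s div 2))) * levi_mat n M $$ (Suc (2 * (s div 2)), s)"
    using assms by (intro sum_pair) (auto simp: levi_mat_index)
  ultimately show ?thesis using assms by (simp add: levi_mat_index)
qed

lemma block_eqI:
  assumes "even n" "A \<in> carrier_mat n n" "B \<in> carrier_mat n n"
    and "\<And>p q u v. Suc (2 * p) < n \<Longrightarrow> Suc (2 * q) < n \<Longrightarrow> u < 2 \<Longrightarrow> v < 2 \<Longrightarrow>
      A $$ (2 * p + u, 2 * q + v) = B $$ (2 * p + u, 2 * q + v)"
  shows "A = B"
proof (rule eq_matI)
  fix r s assume "r < dim_row B" "s < dim_col B"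
  then have "r < n" "s < n" using assms(3) by auto
  then have "Suc (2 * (r div 2)) < n" "Suc (2 * (s div 2)) < n" using assms(1) by presburger+
  then show "A $$ (r, s) = B $$ (r, s)"
    using assms(4)[of "r div 2" "s div 2" "r mod 2" "s mod 2"] by simp
qed (use assms in auto)

text \<open>The map sending M to its negative transpose respects commutators, so the odd diagonal
  blocks of the commutator again carry the negative transpose of [M, N].\<close>

lemma levi_bracket_levi:
  assumes "even n"
  shows "levi_mat n M * levi_mat n N - levi_mat n N * levi_mat n M
    = levi_mat n (\<lambda>u v. (M u 0 * N 0 v + M u 1 * N 1 v) - (N u 0 * M 0 v + N u 1 * M 1 v))"
    (is "_ = ?C")
proof (rule block_eqI[OF assms])
  fix p q u v :: nat
  assume *: "Suc (2 * p) < n" "Suc (2 * q) < n" "u < 2" "v < 2"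
  then have bd: "2 * p + u < n" "2 * q + v < n" "u div 2 = 0" "v div 2 = 0" "u mod 2 = u" "v mod 2 = v"
    by auto
  show "(levi_mat n M * levi_mat n N - levi_mat n N * levi_mat n M) $$ (2 * p + u, 2 * q + v)
    = ?C $$ (2 * p + u, 2 * q + v)"
    using bd(1,2) *(1,2)
    by (simp add: levi_mult_index[OF assms] levi_mat_index bd del: index_mult_mat(1))
qed (auto intro!: minus_carrier_mat)

text \<open>A nonzero block has an even row and an odd column, so the left factor acts on it by M
  and the right factor by the negative transpose of M. This yields M W + W M^t; the blocks carrying
  - W^t transform compatibly.\<close>

lemma levi_bracket_nil:
  assumes "even n" "1 \<le> k"
  shows "levi_mat n M * nil_mat n k W - nil_mat n k W * levi_mat n M
    = nil_mat n k (\<lambda>u v. M u 0 * W 0 v + M u 1 * W 1 v + W u 0 * M v 0 + W u 1 * M v 1)"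
    (is "_ = ?C")
proof (rule block_eqI[OF assms(1)])
  fix p q u v :: nat
  assume *: "Suc (2 * p) < n" "Suc (2 * q) < n" "u < 2" "v < 2"
  then have bd: "2 * p + u < n" "2 * q + v < n" "u div 2 = 0" "v div 2 = 0" "u mod 2 = u" "v mod 2 = v"
    by auto
  show "(levi_mat n M * nil_mat n k W - nil_mat n k W * levi_mat n M) $$ (2 * p + u, 2 * q + v)
    = ?C $$ (2 * p + u, 2 * q + v)"
  proof (cases "even p \<and> odd q")
    case True
    \<comment> \<open>The band conditions depend only on the block (p, q), so all entries occurring
      in the two products share the same \<open>a\<close> and \<open>b\<close>.\<close>
    define a b where "a \<longleftrightarrow> q = p + 2 * k - 1" and "b \<longleftrightarrow> p = q + 2 * k - 1"
    have N: "nil_mat n k V $$ (2 * p + i, 2 * q + j) = (if a then V i j else 0) - (if b then V j i else 0)"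
      if "i < 2" "j < 2" for i j V
    proof -
      have "(2 * p + i) div 2 = p" "(2 * p + i) mod 2 = i" "(2 * q + j) div 2 = q" "(2 * q + j) mod 2 = j"
        "2 * p + i < n" "2 * q + j < n"
        using that * by auto
      then show ?thesis using True by (simp only: nil_mat_index a_def b_def if_True)
    qed
    show ?thesis
      using bd(1,2) *(1,2) True N[OF *(3,4)] N[of 0 v W] N[of 1 v W] N[of u 0 W] N[of u 1 W] *(3,4)
      by (simp add: levi_mult_index[OF assms(1)] mult_levi_index[OF assms(1)] bd del: index_mult_mat(1))
        (simp add: algebra_simps)
  next
    case False
    \<comment> \<open>Multiplication by a block diagonal matrix does not move blocks, so outside the
      corner both products vanish.\<close>
    have zero: "nil_mat n k V $$ (r, s) = 0" if "r < n" "s < n" "odd (r div 2) \<or> even (s div 2)" for r s V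
      using corner_nil_mat[OF assms(2), of n V] that unfolding corner_mat_def by blast
    show ?thesis using False bd(1,2) *(1,2)
      by (auto simp add: levi_mult_index[OF assms(1)] mult_levi_index[OF assms(1)] bd zero
          simp del: index_mult_mat(1))
  qed
qed (auto intro!: minus_carrier_mat)

section \<open>Block structure of the solutions\<close>

lemma levi_mat_block:
  assumes "2 * p + u < n" "2 * q + v < n" "u < 2" "v < 2"
  shows "levi_mat n M $$ (2 * p + u, 2 * q + v)
    = (if p = q then if even p then M u v else - M v u else 0)"
proof -
  have "(2 * p + u) div 2 = p" "(2 * p + u) mod 2 = u" "(2 * q + v) div 2 = q" "(2 * q + v) mod 2 = v"
    using assms by auto
  then show ?thesis using assms by (simp only: levi_mat_index)
qed

lemma nil_mat_block:
  assumes "2 * p + u < n" "2 * q + v < n" "u < 2" "v < 2"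
  shows "nil_mat n k W $$ (2 * p + u, 2 * q + v) = (if even p
    then (if q = p + 2 * k - 1 then W u v else 0) - (if p = q + 2 * k - 1 then W v u else 0) else 0)"
proof -
  have "(2 * p + u) div 2 = p" "(2 * p + u) mod 2 = u" "(2 * q + v) div 2 = q" "(2 * q + v) mod 2 = v"
    using assms by auto
  then show ?thesis using assms by (simp only: nil_mat_index)
qed

lemma if_eq_zero: "(b \<Longrightarrow> x = 0) \<Longrightarrow> (if b then x else 0) = 0"
  by simp

text \<open>A shift by two entries is a shift by one of the 2m + 1 pairs. For j in pair 0 only the
  second term of the equation can survive, giving \<open>first\<close>; for i in pair 2m only the
  first term, giving \<open>last\<close>; otherwise both do, giving \<open>step\<close>.\<close>

lemma sol_A2_blockI:
  assumes n: "n = 4 * m + 2" and X: "X \<in> carrier_mat n n"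
    and first: "\<And>p u v. p < 2 * m \<Longrightarrow> u < 2 \<Longrightarrow> v < 2 \<Longrightarrow> X $$ (2 * Suc p + u, 2 * 0 + v) = 0"
    and last: "\<And>q u v. q < 2 * m \<Longrightarrow> u < 2 \<Longrightarrow> v < 2 \<Longrightarrow> X $$ (2 * q + v, 2 * (2 * m) + u) = 0"
    and step: "\<And>p q u v. p < 2 * m \<Longrightarrow> q < 2 * m \<Longrightarrow> u < 2 \<Longrightarrow> v < 2 \<Longrightarrow>
      X $$ (2 * q + v, 2 * p + u) + X $$ (2 * Suc p + u, 2 * Suc q + v) = 0"
  shows "X \<in> carrier (sol_A2 n)"
  unfolding sol_A2_iff
proof (intro conjI allI impI)
  fix i j assume ij: "i < n" "j < n"
  obtain p u where i: "i = 2 * p + u" "u < 2" by (rule that[of "i div 2" "i mod 2"]) auto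
  obtain q v where j: "j = 2 * q + v" "v < 2" by (rule that[of "j div 2" "j mod 2"]) auto
  have pq: "p \<le> 2 * m" "q \<le> 2 * m" using ij i j n by auto
  have i2: "i + 2 = 2 * Suc p + u" "i + 2 < n \<longleftrightarrow> p < 2 * m" using i n by auto
  let ?a = "if 2 \<le> j then X $$ (j - 2, i) else 0" and ?b = "if i + 2 < n then X $$ (i + 2, j) else 0"
  have b: "?b = (if p < 2 * m then X $$ (2 * Suc p + u, 2 * q + v) else 0)"
    unfolding i2(2) unfolding i2(1) j(1) by (rule refl)
  show "?a + ?b = 0"
  proof (cases q)
    case 0
    then have "?a = 0" using j by simp
    moreover have "?b = 0" unfolding b 0 using first[OF _ i(2) j(2)] by (intro if_eq_zero)
    ultimately show ?thesis by (simp only: add_0)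
  next
    case (Suc q')
    then have j2: "2 \<le> j" "j - 2 = 2 * q' + v" and q': "q' < 2 * m" using j pq by auto
    have a: "?a = X $$ (2 * q' + v, 2 * p + u)" using j2(1) unfolding j2(2) i(1) by (simp only: if_True)
    show ?thesis
    proof (cases "p < 2 * m")
      case True
      then show ?thesis unfolding a b Suc using step[OF True q' i(2) j(2)] by (simp only: if_True)
    next
      case False
      then have "p = 2 * m" using pq by simp
      then show ?thesis unfolding a b using last[OF q' i(2) j(2)] False by (simp only: if_False add_0_right)
    qed
  qed
qed (rule X)

lemma mod_4_eq_2_obtain:
  assumes "n mod 4 = (2 :: nat)"
  obtains m where "n = 4 * m + 2"
  using that[of "n div 4"] assms by (metis mult_div_mod_eq)

text \<open>One step down the block diagonal flips the parity of the pair and thus trades M for its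
  negative transpose, as the step equation demands.\<close>

lemma levi_mat_in_sol:
  assumes "n mod 4 = 2"
  shows "levi_mat n M \<in> carrier (sol_A2 n)"
proof -
  obtain m where n: "n = 4 * m + 2" using assms by (rule mod_4_eq_2_obtain)
  show ?thesis
  proof (rule sol_A2_blockI[OF n])
    fix p u v :: nat assume *: "p < 2 * m" "u < 2" "v < 2"
    have bd: "2 * Suc p + u < n" "2 * 0 + v < n" using * n by auto
    show "levi_mat n M $$ (2 * Suc p + u, 2 * 0 + v) = 0"
      unfolding levi_mat_block[OF bd *(2,3)] by simp
  next
    fix q u v :: nat assume *: "q < 2 * m" "u < 2" "v < 2"
    have bd: "2 * q + v < n" "2 * (2 * m) + u < n" using * n by auto
    show "levi_mat n M $$ (2 * q + v, 2 * (2 * m) + u) = 0"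
      unfolding levi_mat_block[OF bd *(3,2)] using * by simp
  next
    fix p q u v :: nat assume *: "p < 2 * m" "q < 2 * m" "u < 2" "v < 2"
    have bd: "2 * q + v < n" "2 * p + u < n" "2 * Suc p + u < n" "2 * Suc q + v < n" using * n by auto
    show "levi_mat n M $$ (2 * q + v, 2 * p + u) + levi_mat n M $$ (2 * Suc p + u, 2 * Suc q + v) = 0"
      unfolding levi_mat_block[OF bd(1,2) *(4,3)] levi_mat_block[OF bd(3,4) *(3,4)] by simp
  qed simp
qed

text \<open>The step equation for \<open>nil_mat\<close> in the abstract: \<open>c\<close> and
  \<open>d\<close> are the parities of the two blocks, \<open>a\<close> and \<open>b\<close> the two
  band conditions. Inside a band the parities differ, so the two outer conditionals are both active
  or both inactive.\<close>

lemma if_diff_cancel: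
  assumes "a \<or> b \<Longrightarrow> c \<noteq> d"
  shows "(if c then (if a then x else 0) - (if b then y else 0) else 0)
    + (if \<not> d then (if b then y else 0) - (if a then x else 0) else 0) = (0 :: 'a :: ab_group_add)"
  using assms by (cases a; cases b) auto

text \<open>The offset 2k - 1 is odd while pairs 0 and 2m are even, so block columns 0 and 2m are
  empty. Elsewhere the step equation exchanges the bands above and below the diagonal.\<close>

lemma nil_mat_in_sol:
  assumes "n mod 4 = 2" "1 \<le> k"
  shows "nil_mat n k W \<in> carrier (sol_A2 n)"
proof -
  obtain m where n: "n = 4 * m + 2" using assms(1) by (rule mod_4_eq_2_obtain)
  define d where "d = 2 * k - 1"
  have d: "odd d" "x + 2 * k - 1 = x + d" for x using assms(2) by (auto simp: d_def)
  note block = nil_mat_block[of _ _ n _ _ k W, unfolded d(2)]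
  show ?thesis
  proof (rule sol_A2_blockI[OF n])
    fix p u v :: nat assume *: "p < 2 * m" "u < 2" "v < 2"
    have bd: "2 * Suc p + u < n" "2 * 0 + v < n" using * n by auto
    have "Suc p \<noteq> 0 + d \<and> 0 \<noteq> Suc p + d" if "even (Suc p)"
      using that d(1) by (metis add_0 add_is_0 nat.distinct(1))
    then show "nil_mat n k W $$ (2 * Suc p + u, 2 * 0 + v) = 0"
      unfolding block[OF bd *(2,3)] by (intro if_eq_zero) (simp only: if_False diff_self)
  next
    fix q u v :: nat assume *: "q < 2 * m" "u < 2" "v < 2"
    have bd: "2 * q + v < n" "2 * (2 * m) + u < n" using * n by auto
    have "odd (q + d)" if "even q" using that d(1) by simp
    then have "2 * m \<noteq> q + d \<and> q \<noteq> 2 * m + d" if "even q"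
      using that *(1) by (metis dvd_triv_left not_add_less1 less_trans)
    then show "nil_mat n k W $$ (2 * q + v, 2 * (2 * m) + u) = 0"
      unfolding block[OF bd *(3,2)] by (intro if_eq_zero) (simp only: if_False diff_self)
  next
    fix p q u v :: nat assume *: "p < 2 * m" "q < 2 * m" "u < 2" "v < 2"
    have bd: "2 * q + v < n" "2 * p + u < n" "2 * Suc p + u < n" "2 * Suc q + v < n" using * n by auto
    have ne: "even q \<noteq> even p" if "p = q + d \<or> q = p + d" using that d(1) by auto
    show "nil_mat n k W $$ (2 * q + v, 2 * p + u) + nil_mat n k W $$ (2 * Suc p + u, 2 * Suc q + v) = 0"
      unfolding block[OF bd(1,2) *(4,3)] block[OF bd(3,4) *(3,4)] add_Suc nat.inject even_Suc
      using ne by (rule if_diff_cancel)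
  qed simp
qed

section \<open>Decomposition of a solution into a block diagonal matrix and a corner matrix\<close>

lemma sol_A2_blockD:
  assumes n: "n = 4 * m + 2" and X: "X \<in> carrier (sol_A2 n)" and uv: "u < 2" "v < 2"
  shows "p < 2 * m \<Longrightarrow> X $$ (2 * Suc p + u, 2 * 0 + v) = 0"
    and "q < 2 * m \<Longrightarrow> X $$ (2 * q + v, 2 * (2 * m) + u) = 0"
    and "p < 2 * m \<Longrightarrow> q < 2 * m \<Longrightarrow> X $$ (2 * Suc p + u, 2 * Suc q + v) = - X $$ (2 * q + v, 2 * p + u)"
proof -
  show "X $$ (2 * Suc p + u, 2 * 0 + v) = 0" if "p < 2 * m"
  proof -
    have "\<not> 2 \<le> 2 * 0 + v" using uv by simp
    moreover have "X $$ (2 * Suc p + u, 2 * 0 + v) = (if 2 \<le> 2 * 0 + v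
        then - X $$ (2 * 0 + v - 2, 2 * Suc p + u - 2) else 0)"
      using that uv n by (intro sol_A2_pull[OF X]) simp_all
    ultimately show ?thesis by (simp only: if_False)
  qed
  show "X $$ (2 * q + v, 2 * (2 * m) + u) = 0" if "q < 2 * m"
  proof -
    have "\<not> 2 * (2 * m) + u + 2 < n" using n by simp
    moreover have "X $$ (2 * q + v, 2 * (2 * m) + u) = (if 2 * (2 * m) + u + 2 < n
        then - X $$ (2 * (2 * m) + u + 2, 2 * q + v + 2) else 0)"
      using that uv n by (intro sol_A2_push[OF X]) simp_all
    ultimately show ?thesis by (simp only: if_False)
  qed
  show "X $$ (2 * Suc p + u, 2 * Suc q + v) = - X $$ (2 * q + v, 2 * p + u)" if "p < 2 * m" "q < 2 * m"
  proof -
    have "X $$ (2 * Suc p + u, 2 * Suc q + v) = (if 2 \<le> 2 * Suc q + v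
        then - X $$ (2 * Suc q + v - 2, 2 * Suc p + u - 2) else 0)"
      using that uv n by (intro sol_A2_pull[OF X]) simp_all
    moreover have "2 \<le> 2 * Suc q + v" "2 * Suc q + v - 2 = 2 * q + v" "2 * Suc p + u - 2 = 2 * p + u"
      by simp_all
    ultimately show ?thesis by (simp only: if_True)
  qed
qed

text \<open>The step equation reflects blocks and shifts them by one. Following it, every block
  outside the corner reaches block (0, 0), block column 0 below the diagonal, or block column 2m
  above it, where the entries are zero.\<close>

lemma sol_A2_corner:
  assumes "n mod 4 = 2" and Z: "Z \<in> carrier (sol_A2 n)"
    and zero: "\<And>u v. u < 2 \<Longrightarrow> v < 2 \<Longrightarrow> Z $$ (u, v) = 0"
  shows "corner_mat n Z"
proof -
  obtain m where n: "n = 4 * m + 2" using assms(1) by (rule mod_4_eq_2_obtain)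
  define vanish where "vanish p q \<longleftrightarrow> (\<forall>u v. u < 2 \<longrightarrow> v < 2 \<longrightarrow> Z $$ (2 * p + u, 2 * q + v) = 0)" for p q
  have first: "vanish (Suc p) 0" if "p < 2 * m" for p
    using sol_A2_blockD(1)[OF n Z] that unfolding vanish_def by blast
  have last: "vanish q (2 * m)" if "q < 2 * m" for q
    using sol_A2_blockD(2)[OF n Z] that unfolding vanish_def by blast
  \<comment> \<open>Sign and transposition inside the block do not affect its vanishing.\<close>
  have step: "vanish (Suc p) (Suc q) \<longleftrightarrow> vanish q p" if "p < 2 * m" "q < 2 * m" for p q
  proof -
    have "Z $$ (2 * Suc p + u, 2 * Suc q + v) = 0 \<longleftrightarrow> Z $$ (2 * q + v, 2 * p + u) = 0"
      if "u < 2" "v < 2" for u v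
      unfolding sol_A2_blockD(3)[OF n Z that \<open>p < 2 * m\<close> \<open>q < 2 * m\<close>] by (rule neg_equal_0_iff_equal)
    then show ?thesis unfolding vanish_def by blast
  qed
  \<comment> \<open>Two reflections amount to a diagonal shift by two pairs, which preserves
    evenness. On or below the diagonal, shifting up ends in block column 0.\<close>
  have lower: "vanish (2 * p) (2 * q)" if "q \<le> p" "p \<le> m" for p q
    using that
  proof (induction p arbitrary: q)
    case 0
    then show ?case using zero by (simp add: vanish_def)
  next
    case (Suc p)
    show ?case
    proof (cases q)
      case 0
      then show ?thesis using first[of "Suc (2 * p)"] Suc.prems by simp
    next
      case (Suc r)
      then have "vanish (2 * p) (2 * r)" using Suc.IH[of r] Suc.prems by simp
      then show ?thesis
        using step[of "Suc (2 * p)" "Suc (2 * r)"] step[of "2 * r" "2 * p"] Suc Suc.prems by simp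
    qed
  qed
  \<comment> \<open>Above the diagonal, shifting down ends in the last block column, whose index 2m
    is even.\<close>
  have upper: "vanish (2 * p) (2 * q)" if "p < q" "q \<le> m" for p q
    using that
  proof (induction "m - q" arbitrary: p q)
    case 0
    then show ?case using last[of "2 * p"] by simp
  next
    case (Suc l)
    then have "vanish (2 * Suc p) (2 * Suc q)" by (intro Suc.hyps(1)) simp_all
    moreover have "q < m" using Suc.hyps(2) by simp
    ultimately show ?case
      using step[of "Suc (2 * p)" "Suc (2 * q)"] step[of "2 * q" "2 * p"] Suc.prems(1) by simp
  qed
  have even_even: "vanish (2 * p) (2 * q)" if "p \<le> m" "q \<le> m" for p q
    using lower[of q p] upper[of p q] that by (cases "q \<le> p") simp_all
  have odd_odd: "vanish (Suc (2 * p)) (Suc (2 * q))" if "p < m" "q < m" for p q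
    using step[of "2 * p" "2 * q"] even_even[of q p] that by simp
  \<comment> \<open>One reflection keeps the shape odd row, even column, and two lower both indices
    by two, until block column 0 is reached.\<close>
  have odd_even: "vanish (Suc (2 * p)) (2 * q)" if "p < m" "q \<le> m" for p q
    using that
  proof (induction q arbitrary: p)
    case 0
    then show ?case using first[of "2 * p"] by simp
  next
    case (Suc q)
    then have *: "vanish (Suc (2 * p)) (2 * Suc q) \<longleftrightarrow> vanish (Suc (2 * q)) (2 * p)"
      using step[of "2 * p" "Suc (2 * q)"] by simp
    show ?case
    proof (cases p)
      case 0
      then show ?thesis unfolding * using first[of "2 * q"] Suc.prems by simp
    next
      case (Suc r)
      then have "vanish (Suc (2 * q)) (2 * p) \<longleftrightarrow> vanish (Suc (2 * r)) (2 * q)"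
        using step[of "2 * q" "Suc (2 * r)"] Suc.prems by simp
      then show ?thesis unfolding * using Suc.IH[of r] Suc Suc.prems by simp
    qed
  qed
  have "Z $$ (r, s) = 0" if rs: "r < n" "s < n" and "odd (r div 2) \<or> even (s div 2)" for r s
  proof -
    define p q where "p = r div 2" and "q = s div 2"
    have "p \<le> 2 * m" "q \<le> 2 * m" using rs n by (simp_all add: p_def q_def)
    have "vanish p q"
    proof (cases "even p"; cases "even q")
      assume "even p" "even q"
      then obtain p' q' where "p = 2 * p'" "q = 2 * q'" by (auto elim!: evenE)
      then show ?thesis using even_even[of p' q'] \<open>p \<le> 2 * m\<close> \<open>q \<le> 2 * m\<close> by simp
    next
      assume "even p" "odd q"
      then show ?thesis using that(3) by (simp add: p_def q_def)
    next
      assume "odd p" "even q"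
      then obtain p' q' where "p = Suc (2 * p')" "q = 2 * q'" by (auto elim!: evenE oddE)
      then show ?thesis using odd_even[of p' q'] \<open>p \<le> 2 * m\<close> \<open>q \<le> 2 * m\<close> by simp
    next
      assume "odd p" "odd q"
      then obtain p' q' where "p = Suc (2 * p')" "q = Suc (2 * q')" by (auto elim!: oddE)
      then show ?thesis using odd_odd[of p' q'] \<open>p \<le> 2 * m\<close> \<open>q \<le> 2 * m\<close> by simp
    qed
    then have "Z $$ (2 * p + r mod 2, 2 * q + s mod 2) = 0" unfolding vanish_def by simp
    then show ?thesis by (simp add: p_def q_def)
  qed
  moreover have "Z \<in> carrier_mat n n" using Z by (simp add: sol_A2_iff)
  ultimately show ?thesis unfolding corner_mat_def by blast
qed

lemma sol_A2_decomposition: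
  assumes "n mod 4 = 2" "X \<in> carrier (sol_A2 n)"
  obtains M Z where "X = levi_mat n M + Z" "corner_mat n Z"
proof -
  interpret lie_algebra CC "sol_A2 n" by (rule sol_A2_lie_algebra)
  \<comment> \<open>The leading block of X, which is also that of \<open>levi_mat n ?M\<close>; the
    difference \<open>Z\<close> therefore vanishes there and \<open>sol_A2_corner\<close> applies to
    it.\<close>
  let ?M = "\<lambda>u v. X $$ (u, v)"
  have n: "2 \<le> n" using assms(1) by presburger
  have X: "X \<in> carrier_mat n n" using assms(2) by (simp add: sol_A2_iff)
  define Z where "Z = X + (- 1) \<cdot>\<^sub>m levi_mat n ?M"
  have "(- 1) \<cdot>\<^sub>m levi_mat n ?M \<in> carrier (sol_A2 n)"
    using smult_closed[of "- 1", OF _ levi_mat_in_sol[OF assms(1)]] by (simp add: sol_simps)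
  then have "Z \<in> carrier (sol_A2 n)"
    using M.a_closed[OF assms(2)] unfolding Z_def by (simp add: sol_simps)
  moreover have "Z $$ (u, v) = 0" if "u < 2" "v < 2" for u v
    using that n X by (simp add: Z_def levi_mat_index)
  ultimately have "corner_mat n Z" by (rule sol_A2_corner[OF assms(1)])
  moreover have "X = levi_mat n ?M + Z"
    using X by (intro eq_matI) (auto simp: Z_def)
  ultimately show thesis using that by blast
qed

text \<open>The corner part of X annihilates \<open>nil_mat\<close> on both sides, so only its block
  diagonal part acts.\<close>

lemma sol_bracket_nil:
  assumes "n mod 4 = 2" "1 \<le> k" "X \<in> carrier (sol_A2 n)"
  shows "\<exists>V. X * nil_mat n k W - nil_mat n k W * X = nil_mat n k V"
proof -
  obtain M Z where X: "X = levi_mat n M + Z" and Z: "corner_mat n Z"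
    using sol_A2_decomposition[OF assms(1,3)] .
  have N: "corner_mat n (nil_mat n k W)" by (rule corner_nil_mat[OF assms(2)])
  have carr: "Z \<in> carrier_mat n n" using Z by (simp add: corner_mat_def)
  have "X * nil_mat n k W = levi_mat n M * nil_mat n k W" "nil_mat n k W * X = nil_mat n k W * levi_mat n M"
    unfolding X add_mult_distrib_mat[OF levi_mat_carrier carr nil_mat_carrier]
      mult_add_distrib_mat[OF nil_mat_carrier levi_mat_carrier carr]
      corner_mult_corner[OF Z N] corner_mult_corner[OF N Z]
    by (intro right_add_zero_mat mult_carrier_mat[OF levi_mat_carrier nil_mat_carrier]
        mult_carrier_mat[OF nil_mat_carrier levi_mat_carrier])+
  moreover have "even n" using assms(1) by presburger
  ultimately show ?thesis using levi_bracket_nil[OF _ assms(2)] by auto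
qed

section \<open>Generators and ideals\<close>

text \<open>Stated for an abstract additive structure \<open>G\<close>, so that it covers sums taken
  in \<open>gl n\<close> and in \<open>sol_A2 n\<close>.\<close>

lemma finsum_mat_index:
  assumes "abelian_monoid G" "add G = (+)" "zero G = 0\<^sub>m n n" "carrier G \<subseteq> carrier_mat n n"
    and "finite A" "f \<in> A \<rightarrow> carrier G" "r < n" "s < n"
  shows "finsum G f A $$ (r, s) = (\<Sum>i\<in>A. f i $$ (r, s) :: 'a :: comm_monoid_add)"
  using assms(5,6)
proof (induction A rule: finite_induct)
  case empty
  then show ?case using assms by (simp add: abelian_monoid.finsum_empty)
next
  case (insert a A)
  have "f a \<in> carrier_mat n n" "finsum G f A \<in> carrier_mat n n"
    using insert.prems abelian_monoid.finsum_closed[OF assms(1), of f A] assms(4) by auto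
  then show ?case
    using insert assms(2,7,8) by (subst abelian_monoid.finsum_insert[OF assms(1)]) auto
qed

lemma finsum_gl_closed:
  assumes "\<And>i. i \<in> A \<Longrightarrow> f i \<in> carrier_mat n n"
  shows "finsum (gl n) f A \<in> carrier_mat n n"
proof -
  interpret vectorspace CC "gl n" by (rule gl_vs)
  have "finsum (gl n) f A \<in> carrier (gl n)" using assms by (intro M.finsum_closed) auto
  then show ?thesis by simp
qed

lemma unit_mat_carrier [simp]: "unit_mat n i j \<in> carrier_mat n n"
  by (simp add: unit_mat_def)

lemma finsum_gl_index:
  assumes "finite A" "f \<in> A \<rightarrow> carrier_mat n n" "r < n" "s < n"
  shows "finsum (gl n) f A $$ (r, s) = (\<Sum>i\<in>A. f i $$ (r, s))"
proof -
  interpret vectorspace CC "gl n" by (rule gl_vs)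
  show ?thesis using assms by (intro finsum_mat_index M.abelian_monoid_axioms) simp_all
qed

lemma finsum_sol_A2_index:
  assumes "finite A" "f \<in> A \<rightarrow> carrier (sol_A2 n)" "r < n" "s < n"
  shows "finsum (sol_A2 n) f A $$ (r, s) = (\<Sum>i\<in>A. f i $$ (r, s))"
proof -
  interpret lie_algebra CC "sol_A2 n" by (rule sol_A2_lie_algebra)
  show ?thesis
    using assms by (intro finsum_mat_index M.abelian_monoid_axioms) (auto simp: sol_simps)
qed

section \<open>The given generators as block matrices\<close>

lemma sum_indicator_unique:
  assumes "finite A" "\<And>x y. x \<in> A \<Longrightarrow> y \<in> A \<Longrightarrow> P x \<Longrightarrow> P y \<Longrightarrow> x = y"
  shows "(\<Sum>x\<in>A. if P x then 1 else 0) = (if \<exists>x\<in>A. P x then 1 else (0 :: 'a :: semiring_1))"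
proof (cases "\<exists>x\<in>A. P x")
  case True
  then obtain x where x: "x \<in> A" "P x" by blast
  then have "(\<Sum>y\<in>A. if P y then 1 else 0) = (\<Sum>y\<in>A. if y = x then 1 else (0 :: 'a))"
    using assms(2) by (intro sum.cong) auto
  then show ?thesis using x assms(1) by auto
next
  case False
  then show ?thesis by (auto intro: sum.neutral)
qed

lemma double_add_eq_iff:
  assumes "u < 2" "a < (2 :: nat)"
  shows "2 * p + u = 2 * i + a \<longleftrightarrow> p = i \<and> u = a"
  using assms by presburger

text \<open>The \<open>+ 1\<close> passes from 0-based positions to the 1-based indices of
  \<open>unit_mat\<close>; i and j are pairs, a and b positions within them.\<close>

lemma unit_mat_block:
  assumes "2 * p + u < n" "2 * q + v < n" "u < 2" "v < 2" "a < 2" "b < 2"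
  shows "unit_mat n (2 * i + a + 1) (2 * j + b + 1) $$ (2 * p + u, 2 * q + v)
    = (if p = i \<and> u = a \<and> q = j \<and> v = b then 1 else 0)"
  unfolding unit_mat_def index_mat(1)[OF assms(1,2)] prod.case add_right_cancel
    double_add_eq_iff[OF assms(3,5)] double_add_eq_iff[OF assms(4,6)] conj_assoc by (rule refl)

text \<open>Common form of all eight generators: the block offset \<open>d\<close> is 0 for
  \<open>el_h1\<close>, \<open>el_h2\<close>, \<open>el_e\<close>, \<open>el_f\<close> and 2k - 1
  for the others. The two range conditions say that the summation reaches every matching block
  inside the matrix.\<close>

lemma finsum_unit_mat_block:
  assumes "2 * p + u < n" "2 * q + v < n" "u < 2" "v < 2" "a < 2" "b < 2"
    and range: "\<forall>l. p = 2 * l \<and> q = 2 * l + d \<longrightarrow> l \<in> range_l n k"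
      "\<forall>l. p = 2 * l + 1 + d \<and> q = 2 * l + 1 \<longrightarrow> l \<in> range_l n k"
  shows "(\<Oplus>\<^bsub>gl n\<^esub>l\<in>range_l n k. unit_mat n (2 * (2 * l) + a + 1) (2 * (2 * l + d) + b + 1)
      - unit_mat n (2 * (2 * l + 1 + d) + b + 1) (2 * (2 * l + 1) + a + 1)) $$ (2 * p + u, 2 * q + v)
    = (if (even p \<and> q = p + d) \<and> u = a \<and> v = b then 1 else 0)
      - (if (odd q \<and> p = q + d) \<and> v = a \<and> u = b then 1 else 0)" (is "?L = _")
proof -
  have "range_l n k \<subseteq> {..n}" by (auto simp: range_l_def)
  then have fin: "finite (range_l n k)" by (rule finite_subset) simp
  have dim: "dim_row (unit_mat n i j) = n" "dim_col (unit_mat n i j) = n" for i j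
    by (simp_all add: unit_mat_def)
  have "?L = (\<Sum>l\<in>range_l n k. (if p = 2 * l \<and> u = a \<and> q = 2 * l + d \<and> v = b then 1 else 0)
      - (if p = 2 * l + 1 + d \<and> u = b \<and> q = 2 * l + 1 \<and> v = a then 1 else 0))"
    using assms(1-6) fin
    by (subst finsum_gl_index)
      (simp_all only: unit_mat_block index_minus_mat dim Pi_iff carrier_mat_def, simp add: dim)
  also have "\<dots> = (if \<exists>l\<in>range_l n k. p = 2 * l \<and> u = a \<and> q = 2 * l + d \<and> v = b then 1 else 0)
      - (if \<exists>l\<in>range_l n k. p = 2 * l + 1 + d \<and> u = b \<and> q = 2 * l + 1 \<and> v = a then 1 else 0)"
    unfolding sum_subtractf by (intro arg_cong2[of _ _ _ _ "(-)"] sum_indicator_unique fin) auto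
  also have "(\<exists>l\<in>range_l n k. p = 2 * l \<and> u = a \<and> q = 2 * l + d \<and> v = b)
      \<longleftrightarrow> (even p \<and> q = p + d) \<and> u = a \<and> v = b"
    using range(1) by (auto elim!: evenE)
  also have "(\<exists>l\<in>range_l n k. p = 2 * l + 1 + d \<and> u = b \<and> q = 2 * l + 1 \<and> v = a)
      \<longleftrightarrow> (odd q \<and> p = q + d) \<and> v = a \<and> u = b"
    using range(2) by (auto elim!: oddE)
  finally show ?thesis .
qed

abbreviation unit2 :: "nat \<Rightarrow> nat \<Rightarrow> nat \<Rightarrow> nat \<Rightarrow> complex" where
  "unit2 a b u v \<equiv> if u = a \<and> v = b then 1 else 0"

lemma levi_mat_unit2:
  assumes "n mod 4 = 2" "a < 2" "b < 2"
  shows "(\<Oplus>\<^bsub>gl n\<^esub>l\<in>range_l n 0. unit_mat n (2 * (2 * l) + a + 1) (2 * (2 * l + 0) + b + 1)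
      - unit_mat n (2 * (2 * l + 1 + 0) + b + 1) (2 * (2 * l + 1) + a + 1)) = levi_mat n (unit2 a b)"
proof -
  obtain m where n: "n = 4 * m + 2" using assms(1) by (rule mod_4_eq_2_obtain)
  show ?thesis
  proof (rule block_eqI)
    fix p q u v :: nat assume *: "Suc (2 * p) < n" "Suc (2 * q) < n" "u < 2" "v < 2"
    then have bd: "2 * p + u < n" "2 * q + v < n" by auto
    have range: "\<forall>l. p = 2 * l \<and> q = 2 * l + 0 \<longrightarrow> l \<in> range_l n 0"
      using *(1) n unfolding range_l_def mem_Collect_eq by presburger
    have range': "\<forall>l. p = 2 * l + 1 + 0 \<and> q = 2 * l + 1 \<longrightarrow> l \<in> range_l n 0"
      using *(1) n unfolding range_l_def mem_Collect_eq by presburger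
    show "(\<Oplus>\<^bsub>gl n\<^esub>l\<in>range_l n 0. unit_mat n (2 * (2 * l) + a + 1) (2 * (2 * l + 0) + b + 1)
        - unit_mat n (2 * (2 * l + 1 + 0) + b + 1) (2 * (2 * l + 1) + a + 1)) $$ (2 * p + u, 2 * q + v)
      = levi_mat n (unit2 a b) $$ (2 * p + u, 2 * q + v)"
      unfolding finsum_unit_mat_block[OF bd *(3,4) assms(2,3) range range'] levi_mat_block[OF bd *(3,4)]
      by (cases "even p"; cases "p = q") auto
  qed (use n in \<open>auto intro!: finsum_gl_closed minus_carrier_mat\<close>)
qed

lemma if_conj_diff:
  "(if (a \<and> b) \<and> s then x else 0) - (if (a \<and> c) \<and> t then y else 0)
    = (if a then (if b then if s then x else 0 else 0) - (if c then if t then y else 0 else 0)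
       else (0 :: 'a :: ab_group_add))"
  by simp

lemma nil_mat_unit2:
  assumes "n mod 4 = 2" "1 \<le> k" "a < 2" "b < 2"
  shows "(\<Oplus>\<^bsub>gl n\<^esub>l\<in>range_l n k. unit_mat n (2 * (2 * l) + a + 1) (2 * (2 * l + (2 * k - 1)) + b + 1)
      - unit_mat n (2 * (2 * l + 1 + (2 * k - 1)) + b + 1) (2 * (2 * l + 1) + a + 1))
    = nil_mat n k (unit2 a b)"
proof -
  obtain m where n: "n = 4 * m + 2" using assms(1) by (rule mod_4_eq_2_obtain)
  define d where "d = 2 * k - 1"
  have d: "odd d" "x + 2 * k - 1 = x + d" for x using assms(2) by (auto simp: d_def)
  show ?thesis unfolding d_def[symmetric]
  proof (rule block_eqI)
    fix p q u v :: nat assume *: "Suc (2 * p) < n" "Suc (2 * q) < n" "u < 2" "v < 2"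
    then have bd: "2 * p + u < n" "2 * q + v < n" by auto
    \<comment> \<open>A block column inside the matrix only gives 4l + 4k \<le> n; since n is 2
      modulo 4, this improves to 4l + 4k + 2 \<le> n.\<close>
    have range: "\<forall>l. p = 2 * l \<and> q = 2 * l + d \<longrightarrow> l \<in> range_l n k"
      using *(2) n assms(2) unfolding range_l_def d_def mem_Collect_eq by presburger
    have range': "\<forall>l. p = 2 * l + 1 + d \<and> q = 2 * l + 1 \<longrightarrow> l \<in> range_l n k"
      using *(1) n assms(2) unfolding range_l_def d_def mem_Collect_eq by presburger
    \<comment> \<open>The sum restricts the lower band by the parity of the column,
      \<open>nil_mat\<close> by that of the row; they agree because d is odd.\<close>
    have parity: "odd q \<and> p = q + d \<longleftrightarrow> even p \<and> p = q + d" using d(1) by auto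
    show "(\<Oplus>\<^bsub>gl n\<^esub>l\<in>range_l n k. unit_mat n (2 * (2 * l) + a + 1) (2 * (2 * l + d) + b + 1)
        - unit_mat n (2 * (2 * l + 1 + d) + b + 1) (2 * (2 * l + 1) + a + 1)) $$ (2 * p + u, 2 * q + v)
      = nil_mat n k (unit2 a b) $$ (2 * p + u, 2 * q + v)"
      unfolding finsum_unit_mat_block[OF bd *(3,4) assms(3,4) range range']
        nil_mat_block[OF bd *(3,4), of k, unfolded d(2)] parity
      by (rule if_conj_diff)
  qed (use n in \<open>auto intro!: finsum_gl_closed minus_carrier_mat\<close>)
qed

text \<open>Matches indices under the sum, such as \<open>1 + 4*l\<close>, with their block form by
  four arithmetic identities.\<close>

lemma finsum_unit_mat_cong:
  assumes "finsum (gl n) (\<lambda>l. unit_mat n (i l) (j l) - unit_mat n (i' l) (j' l)) A = X"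
    and "\<And>l. a l = i l" "\<And>l. b l = j l" "\<And>l. a' l = i' l" "\<And>l. b' l = j' l"
  shows "finsum (gl n) (\<lambda>l. unit_mat n (a l) (b l) - unit_mat n (a' l) (b' l)) A = X"
  using assms by simp

lemma generators_levi:
  assumes "n mod 4 = 2"
  shows "el_h1 n = levi_mat n (unit2 0 0)" "el_e n = levi_mat n (unit2 0 1)"
    "el_f n = levi_mat n (unit2 1 0)" "el_h2 n = levi_mat n (unit2 1 1)"
  unfolding el_h1_def el_e_def el_f_def el_h2_def
  by (rule finsum_unit_mat_cong, rule levi_mat_unit2[OF assms]; simp)+

lemma generators_nil:
  assumes "n mod 4 = 2" "1 \<le> k"
  shows "el_a n k = nil_mat n k (unit2 0 0)" "el_b n k = nil_mat n k (unit2 0 1)"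
    "el_c n k = nil_mat n k (unit2 1 0)" "el_d n k = nil_mat n k (unit2 1 1)"
  unfolding el_a_def el_b_def el_c_def el_d_def
  \<comment> \<open>With k \<ge> 1 the truncated differences \<open>4*l + 4*k - 1\<close> and
    \<open>2 * k - 1\<close> are genuine.\<close>
  by (rule finsum_unit_mat_cong, rule nil_mat_unit2[OF assms]; use assms(2) in presburger)+


lemma nil_mat_cong:
  assumes "\<And>u v. u < 2 \<Longrightarrow> v < 2 \<Longrightarrow> V u v = W u v"
  shows "nil_mat n k V = nil_mat n k W"
  using assms by (auto simp: nil_mat_def intro!: cong_mat)

lemma levi_mat_cong:
  assumes "\<And>u v. u < 2 \<Longrightarrow> v < 2 \<Longrightarrow> M u v = N u v"
  shows "levi_mat n M = levi_mat n N"
  using assms by (auto simp: levi_mat_def intro!: cong_mat)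

lemma nil_mat_add: "nil_mat n k V + nil_mat n k W = nil_mat n k (\<lambda>u v. V u v + W u v)"
  by (rule eq_matI) (simp_all add: nil_mat_def)

lemma nil_mat_smult: "c \<cdot>\<^sub>m nil_mat n k W = nil_mat n k (\<lambda>u v. c * W u v)"
  by (rule eq_matI) (simp_all add: nil_mat_def right_diff_distrib)

lemma nil_mat_zero: "nil_mat n k (\<lambda>_ _. 0) = 0\<^sub>m n n"
  by (rule eq_matI) (simp_all add: nil_mat_def)

lemma levi_mat_add: "levi_mat n M + levi_mat n N = levi_mat n (\<lambda>u v. M u v + N u v)"
  by (rule eq_matI) (simp_all add: levi_mat_def)

lemma levi_mat_smult: "c \<cdot>\<^sub>m levi_mat n M = levi_mat n (\<lambda>u v. c * M u v)"
  by (rule eq_matI) (simp_all add: levi_mat_def)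

lemma levi_mat_zero: "levi_mat n (\<lambda>_ _. 0) = 0\<^sub>m n n"
  by (rule eq_matI) (simp_all add: levi_mat_def)

lemma unit2_expansion:
  assumes "u < 2" "v < 2"
  shows "M u v = M 0 0 * unit2 0 0 u v + M 0 1 * unit2 0 1 u v + M 1 0 * unit2 1 0 u v + M 1 1 * unit2 1 1 u v"
  using assms by (auto simp: less_2_cases_iff)

section \<open>The ideals \<open>ideal_b\<close> and \<open>ideal_a\<close>\<close>

lemma nil_mat_lie_ideal:
  assumes "n mod 4 = 2" "1 \<le> k"
  shows "lie_ideal CC (range (nil_mat n k)) (sol_A2 n)"
proof -
  interpret lie_algebra CC "sol_A2 n" by (rule sol_A2_lie_algebra)
  show ?thesis
  proof (rule lie_idealI)
    show "range (nil_mat n k) \<subseteq> carrier (sol_A2 n)" using nil_mat_in_sol[OF assms] by blast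
    show "\<zero>\<^bsub>sol_A2 n\<^esub> \<in> range (nil_mat n k)" by (simp add: sol_simps flip: nil_mat_zero[of n k])
    fix X Y assume "X \<in> carrier (sol_A2 n)" "Y \<in> range (nil_mat n k)"
    then show "bracket (sol_A2 n) X Y \<in> range (nil_mat n k)"
      using sol_bracket_nil[OF assms] unfolding sol_simps(5) by blast
  qed (auto simp: sol_simps(3,4) nil_mat_add nil_mat_smult)
qed

lemma ideal_b_eq:
  assumes "n mod 4 = 2" "1 \<le> k"
  shows "ideal_b n k = range (nil_mat n k)"
proof
  interpret lie_algebra CC "sol_A2 n" by (rule sol_A2_lie_algebra)
  let ?S = "{el_a n k, el_b n k, el_c n k, el_d n k}"
  have S: "?S \<subseteq> range (nil_mat n k)"
    unfolding generators_nil[OF assms] by (simp only: insert_subset rangeI empty_subsetI simp_thms)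
  have "submodule CC (range (nil_mat n k)) (sol_A2 n)"
    using nil_mat_lie_ideal[OF assms] by (simp add: lie_ideal_def subspace_def)
  with S show "ideal_b n k \<subseteq> range (nil_mat n k)" unfolding ideal_b_def by (rule span_is_subset)
  have SC: "?S \<subseteq> carrier (sol_A2 n)" 
    unfolding generators_nil[OF assms] by (simp only: insert_subset nil_mat_in_sol[OF assms] empty_subsetI simp_thms)
  have sub: "submodule CC (span ?S) (sol_A2 n)" by (rule span_is_submodule[OF SC])
  have gen: "nil_mat n k (unit2 0 0) \<in> span ?S" "nil_mat n k (unit2 0 1) \<in> span ?S"
    "nil_mat n k (unit2 1 0) \<in> span ?S" "nil_mat n k (unit2 1 1) \<in> span ?S"
    using in_own_span[OF SC] unfolding generators_nil[OF assms] by (simp_all only: insert_subset simp_thms)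
  have add: "X + Y \<in> span ?S" if "X \<in> span ?S" "Y \<in> span ?S" for X Y
    using submodule.m_closed[OF sub that] by (simp add: sol_simps(3))
  have smult: "c \<cdot>\<^sub>m X \<in> span ?S" if "X \<in> span ?S" for c X
    using submodule.smult_closed[OF sub _ that] by (simp add: sol_simps(4))
  show "range (nil_mat n k) \<subseteq> ideal_b n k"
  proof
    fix X assume "X \<in> range (nil_mat n k)"
    then obtain W where X: "X = nil_mat n k W" by blast
    have "X = W 0 0 \<cdot>\<^sub>m nil_mat n k (unit2 0 0) + W 0 1 \<cdot>\<^sub>m nil_mat n k (unit2 0 1)
        + W 1 0 \<cdot>\<^sub>m nil_mat n k (unit2 1 0) + W 1 1 \<cdot>\<^sub>m nil_mat n k (unit2 1 1)"
      unfolding X nil_mat_smult nil_mat_add by (rule nil_mat_cong) (rule unit2_expansion)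
    also have "\<dots> \<in> span ?S" by (intro add smult gen)
    finally show "X \<in> ideal_b n k" unfolding ideal_b_def .
  qed
qed

lemma ideal_a_lie_ideal:
  assumes "n mod 4 = 2" "1 \<le> k"
  shows "lie_ideal CC (ideal_a n k) (sol_A2 n)"
proof -
  interpret lie_algebra CC "sol_A2 n" by (rule sol_A2_lie_algebra)
  show ?thesis unfolding ideal_a_def
  proof (rule family_sum_lie_ideal)
    fix i assume "i \<in> {k..(n - 2) div 4}"
    then have "1 \<le> i" using assms(2) by simp
    then show "lie_ideal CC (ideal_b n i) (sol_A2 n)"
      by (simp only: ideal_b_eq[OF assms(1)] nil_mat_lie_ideal[OF assms(1)])
  qed simp
qed

lemma corner_ideal_a:
  assumes "n mod 4 = 2" "1 \<le> k" "X \<in> ideal_a n k"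
  shows "corner_mat n X"
proof -
  let ?I = "{k..(n - 2) div 4}"
  obtain v where v: "v \<in> Pi ?I (ideal_b n)" "X = finsum (sol_A2 n) v ?I"
    using assms(3) by (auto simp: ideal_a_def family_sum_def)
  have vi: "v i \<in> range (nil_mat n i)" if "i \<in> ?I" for i
    using v(1) that ideal_b_eq[OF assms(1), of i] assms(2) by (auto simp: Pi_iff)
  have carr: "v \<in> ?I \<rightarrow> carrier (sol_A2 n)"
  proof
    fix i assume i: "i \<in> ?I"
    then have "1 \<le> i" using assms(2) by simp
    then show "v i \<in> carrier (sol_A2 n)" using vi[OF i] nil_mat_in_sol[OF assms(1)] by fastforce
  qed
  have corner: "corner_mat n (v i)" if i: "i \<in> ?I" for i
  proof -
    have "1 \<le> i" using assms(2) i by simp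
    then show ?thesis using vi[OF i] corner_nil_mat by fastforce
  qed
  have "X \<in> carrier (sol_A2 n)"
    using ideal_a_lie_ideal[OF assms(1,2)] assms(3)
    by (auto simp: lie_ideal_def subspace_def submodule_def)
  moreover have "X $$ (r, s) = 0" if "r < n" "s < n" "odd (r div 2) \<or> even (s div 2)" for r s
  proof -
    have "X $$ (r, s) = (\<Sum>i\<in>?I. v i $$ (r, s))"
      unfolding v(2) by (rule finsum_sol_A2_index[OF _ carr that(1,2)]) simp
    also have "\<dots> = 0"
    proof (rule sum.neutral, rule ballI)
      fix i assume "i \<in> ?I"
      from corner[OF this] that show "v i $$ (r, s) = 0" unfolding corner_mat_def by blast
    qed
    finally show ?thesis .
  qed
  ultimately show ?thesis unfolding corner_mat_def sol_A2_iff by blast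
qed

lemma ideal_a_bracket_zero:
  assumes "n mod 4 = 2" "1 \<le> k" "X \<in> ideal_a n k" "Y \<in> ideal_a n k"
  shows "bracket (sol_A2 n) X Y = \<zero>\<^bsub>sol_A2 n\<^esub>"
  using corner_mult_corner[OF corner_ideal_a[OF assms(1-3)] corner_ideal_a[OF assms(1,2,4)]]
    corner_mult_corner[OF corner_ideal_a[OF assms(1,2,4)] corner_ideal_a[OF assms(1-3)]]
  by (simp add: sol_simps)

text \<open>All brackets vanish, so only 0 has to lie in \<open>ideal_a n (k + 1)\<close>; this
  includes the case of an empty index set, where that ideal is zero.\<close>

lemma ideal_a_bracket_space:
  assumes "n mod 4 = 2" "1 \<le> k"
  shows "bracket_space CC (sol_A2 n) (ideal_a n k) (ideal_a n k) \<subseteq> ideal_a n (k + 1)"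
proof -
  interpret lie_algebra CC "sol_A2 n" by (rule sol_A2_lie_algebra)
  have "bracket_space CC (sol_A2 n) (ideal_a n k) (ideal_a n k) = {\<zero>\<^bsub>sol_A2 n\<^esub>}"
    unfolding bracket_space_def
    by (rule span_subset_zero) (auto simp: ideal_a_bracket_zero[OF assms])
  moreover have "\<zero>\<^bsub>sol_A2 n\<^esub> \<in> ideal_a n (k + 1)"
    using ideal_a_lie_ideal[OF assms(1), of "k + 1"]
    by (simp add: lie_ideal_def subspace_def submodule_def)
  ultimately show ?thesis by simp
qed

lemma ideal_b_direct:
  assumes "n mod 4 = 2" "1 \<le> k"
  shows "family_direct (sol_A2 n) {k..(n - 2) div 4} (ideal_b n)"
  unfolding family_direct_def
proof (intro ballI impI)
  let ?I = "{k..(n - 2) div 4}"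
  obtain m where n: "n = 4 * m + 2" using assms(1) by (rule mod_4_eq_2_obtain)
  fix v i assume v: "v \<in> Pi ?I (ideal_b n)" and zero: "finsum (sol_A2 n) v ?I = \<zero>\<^bsub>sol_A2 n\<^esub>"
    and i: "i \<in> ?I"
  have "\<exists>W. v j = nil_mat n j W" if "j \<in> ?I" for j
    using v that ideal_b_eq[OF assms(1), of j] assms(2) by (auto simp: Pi_iff)
  then obtain W where W: "\<And>j. j \<in> ?I \<Longrightarrow> v j = nil_mat n j (W j)" by metis
  have carr: "v \<in> ?I \<rightarrow> carrier (sol_A2 n)"
    using W nil_mat_in_sol[OF assms(1)] assms(2) by auto
  have "W i a b = 0" if ab: "a < 2" "b < 2" for a b
  proof -
    have im: "1 \<le> i" "i \<le> m" using i n assms(2) by auto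
    \<comment> \<open>In block row 0 the j-th summand is supported at block column 2j - 1, so block
      (0, 2i - 1) of the sum is exactly \<open>W i\<close>.\<close>
    have bd: "2 * 0 + a < n" "2 * (2 * i - 1) + b < n" using im ab n by auto
    have "(\<Sum>j\<in>?I. v j $$ (2 * 0 + a, 2 * (2 * i - 1) + b)) = 0"
      using zero bd unfolding finsum_sol_A2_index[OF finite_atLeastAtMost carr bd, symmetric]
      by (simp add: sol_simps)
    also have "(\<Sum>j\<in>?I. v j $$ (2 * 0 + a, 2 * (2 * i - 1) + b)) = (\<Sum>j\<in>?I. if j = i then W i a b else 0)"
    proof (rule sum.cong)
      fix j assume j: "j \<in> ?I"
      have "1 \<le> j" using j assms(2) by simp
      then have "2 * i - 1 = 0 + 2 * j - 1 \<longleftrightarrow> j = i" "0 \<noteq> 2 * i - 1 + 2 * j - 1" using im by auto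
      then show "v j $$ (2 * 0 + a, 2 * (2 * i - 1) + b) = (if j = i then W i a b else 0)"
        unfolding W[OF j] nil_mat_block[OF bd ab] by simp
    qed simp
    also have "\<dots> = W i a b" using i by simp
    finally show ?thesis .
  qed
  then have "v i = nil_mat n i (\<lambda>_ _. 0)" unfolding W[OF i] by (intro nil_mat_cong)
  then show "v i = \<zero>\<^bsub>sol_A2 n\<^esub>" by (simp add: nil_mat_zero sol_simps)
qed

section \<open>The reductive part\<close>

lemma levi_mat_lie_subalgebra:
  assumes "n mod 4 = 2"
  shows "lie_subalgebra CC (range (levi_mat n)) (sol_A2 n)"
proof -
  interpret lie_algebra CC "sol_A2 n" by (rule sol_A2_lie_algebra)
  have "even n" using assms by presburger
  show ?thesis
  proof (rule lie_subalgebraI)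
    show "range (levi_mat n) \<subseteq> carrier (sol_A2 n)" using levi_mat_in_sol[OF assms] by auto
    show "\<zero>\<^bsub>sol_A2 n\<^esub> \<in> range (levi_mat n)" by (simp add: sol_simps flip: levi_mat_zero[of n])
  qed (auto simp: sol_simps(3-5) levi_mat_add levi_mat_smult levi_bracket_levi[OF \<open>even n\<close>])
qed

text \<open>The four generators are the images of the matrix units and already span a subalgebra
  linearly, so brackets add nothing.\<close>

lemma lie_generated_levi:
  assumes "n mod 4 = 2"
  shows "lie_generated CC (sol_A2 n) {el_h1 n, el_h2 n, el_e n, el_f n} = range (levi_mat n)"
proof
  show "lie_generated CC (sol_A2 n) {el_h1 n, el_h2 n, el_e n, el_f n} \<subseteq> range (levi_mat n)"
    unfolding lie_generated_def generators_levi[OF assms]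
    using levi_mat_lie_subalgebra[OF assms] by (intro Inter_lower CollectI conjI) simp_all
  show "range (levi_mat n) \<subseteq> lie_generated CC (sol_A2 n) {el_h1 n, el_h2 n, el_e n, el_f n}"
    unfolding lie_generated_def
  proof (rule Inter_greatest)
    fix H assume "H \<in> {H. lie_subalgebra CC H (sol_A2 n) \<and> {el_h1 n, el_h2 n, el_e n, el_f n} \<subseteq> H}"
    then have sub: "lie_subalgebra CC H (sol_A2 n)"
      and gen: "levi_mat n (unit2 0 0) \<in> H" "levi_mat n (unit2 1 1) \<in> H"
        "levi_mat n (unit2 0 1) \<in> H" "levi_mat n (unit2 1 0) \<in> H"
      unfolding generators_levi[OF assms] by simp_all
    have sm: "submodule CC H (sol_A2 n)" using sub by (simp add: lie_subalgebra_def subspace_def)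
    have add: "X + Y \<in> H" if "X \<in> H" "Y \<in> H" for X Y
      using submodule.m_closed[OF sm that] by (simp add: sol_simps(3))
    have smult: "c \<cdot>\<^sub>m X \<in> H" if "X \<in> H" for c X
      using submodule.smult_closed[OF sm _ that] by (simp add: sol_simps(4))
    show "range (levi_mat n) \<subseteq> H"
    proof
      fix X assume "X \<in> range (levi_mat n)"
      then obtain M where X: "X = levi_mat n M" by blast
      have "X = M 0 0 \<cdot>\<^sub>m levi_mat n (unit2 0 0) + M 0 1 \<cdot>\<^sub>m levi_mat n (unit2 0 1)
          + M 1 0 \<cdot>\<^sub>m levi_mat n (unit2 1 0) + M 1 1 \<cdot>\<^sub>m levi_mat n (unit2 1 1)"
        unfolding X levi_mat_smult levi_mat_add by (rule levi_mat_cong) (rule unit2_expansion)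
      also have "\<dots> \<in> H" by (intro add smult gen)
      finally show "X \<in> H" .
    qed
  qed
qed

text \<open>Since the leading 2 by 2 block of \<open>levi_mat n M\<close> is \<open>M\<close>, this is \<open>M \<mapsto> (M - tr M / 2, tr M)\<close>.\<close>

definition split_trace :: "complex mat \<Rightarrow> complex mat \<times> complex" where
  "split_trace X = (mat 2 2 (\<lambda>(i, j). X $$ (i, j) - (if i = j then (X $$ (0, 0) + X $$ (1, 1)) / 2 else 0)),
     X $$ (0, 0) + X $$ (1, 1))"

lemma split_trace_levi:
  assumes "2 \<le> n"
  shows "split_trace (levi_mat n M) = (mat 2 2 (\<lambda>(i, j). M i j - (if i = j then (M 0 0 + M 1 1) / 2 else 0)),
     M 0 0 + M 1 1)"
  using assms by (auto simp: split_trace_def levi_mat_index intro!: cong_mat)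

lemma direct_sum_sl2_simps:
  "carrier (lie_direct_sum (sl 2) lie_C) = {X \<in> carrier_mat 2 2. X $$ (0, 0) + X $$ (1, 1) = 0} \<times> UNIV"
  "add (lie_direct_sum (sl 2) lie_C) = (\<lambda>x y. (fst x + fst y, snd x + snd y))"
  "smult (lie_direct_sum (sl 2) lie_C) = (\<lambda>c x. (c \<cdot>\<^sub>m fst x, c * snd x))"
  "bracket (lie_direct_sum (sl 2) lie_C) = (\<lambda>x y. (fst x * fst y - fst y * fst x, 0))"
  by (simp_all add: lie_direct_sum_def module.defs lie.defs direct_sum_def sl_def lie_C_def
      numeral_2_eq_2)

lemma levi_isomorphic:
  assumes "n mod 4 = 2"
  shows "lie_isomorphic CC ((sol_A2 n)\<lparr>carrier := range (levi_mat n)\<rparr>) (lie_direct_sum (sl 2) lie_C)"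
proof -
  let ?L = "(sol_A2 n)\<lparr>carrier := range (levi_mat n)\<rparr>" and ?D = "lie_direct_sum (sl 2) lie_C"
  have n: "2 \<le> n" "even n" using assms by presburger+
  have L: "lie_algebra CC ?L" by (rule lie_subalgebra_is_lie[OF levi_mat_lie_subalgebra[OF assms]])
  have D: "lie_algebra CC ?D" by (rule lie_algebra_direct_sum[OF sl_lie_algebra lie_C_lie_algebra])
  interpret L: lie_algebra CC ?L by (rule L)
  interpret D: lie_algebra CC ?D by (rule D)
  have carr: "split_trace (levi_mat n M) \<in> carrier ?D" for M
    by (simp add: split_trace_levi[OF n(1)] direct_sum_sl2_simps field_simps)
  have add: "split_trace (levi_mat n M + levi_mat n N)
      = split_trace (levi_mat n M) \<oplus>\<^bsub>?D\<^esub> split_trace (levi_mat n N)" for M N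
    unfolding levi_mat_add split_trace_levi[OF n(1)] direct_sum_sl2_simps
    by (auto intro!: eq_matI simp: field_simps)
  have smult: "split_trace (c \<cdot>\<^sub>m levi_mat n M) = c \<odot>\<^bsub>?D\<^esub> split_trace (levi_mat n M)" for c M
    unfolding levi_mat_smult split_trace_levi[OF n(1)] direct_sum_sl2_simps
    by (auto intro!: eq_matI simp: field_simps)
  have sum2: "(\<Sum>i = 0..<2. f i) = f 0 + f 1" for f :: "nat \<Rightarrow> complex"
    by (simp add: numeral_2_eq_2)
  \<comment> \<open>Scalar matrices are central and commutators are traceless, so both sides are
    ([M, N], 0).\<close>
  have bracket: "split_trace (levi_mat n M * levi_mat n N - levi_mat n N * levi_mat n M)
      = bracket ?D (split_trace (levi_mat n M)) (split_trace (levi_mat n N))" for M N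
    unfolding levi_bracket_levi[OF n(2)] split_trace_levi[OF n(1)] direct_sum_sl2_simps
    by (auto intro!: eq_matI simp: scalar_prod_def sum2 field_simps less_2_cases_iff)
  have hom: "linear_map CC ?L ?D split_trace"
    using carr add smult
    by (intro linear_map.intro mod_hom.intro mod_hom_axioms.intro L.vectorspace_axioms D.vectorspace_axioms
        L.module_axioms D.module_axioms)
      (auto simp: LinearCombinations.module_hom_def sol_simps(3,4))
  have inj: "inj_on split_trace (range (levi_mat n))"
  proof (rule inj_onI)
    fix X Y assume "X \<in> range (levi_mat n)" "Y \<in> range (levi_mat n)" and eq: "split_trace X = split_trace Y"
    then obtain M N where X: "X = levi_mat n M" and Y: "Y = levi_mat n N" by blast
    \<comment> \<open>Equal second components mean that the same scalar was subtracted in the first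
      components.\<close>
    have tr: "M 0 0 + M 1 1 = N 0 0 + N 1 1" using eq unfolding X Y split_trace_levi[OF n(1)] by simp
    have "M u v = N u v" if "u < 2" "v < 2" for u v
    proof -
      have "fst (split_trace X) $$ (u, v) = fst (split_trace Y) $$ (u, v)" using eq by (rule arg_cong)
      then have "M u v - (if u = v then (N 0 0 + N 1 1) / 2 else 0)
          = N u v - (if u = v then (N 0 0 + N 1 1) / 2 else 0)"
        using that unfolding X Y split_trace_levi[OF n(1)] tr fst_conv by (simp only: index_mat prod.case)
      then show ?thesis by (simp only: diff_eq_eq diff_add_cancel)
    qed
    then show "X = Y" unfolding X Y by (rule levi_mat_cong)
  qed
  have surj: "split_trace ` range (levi_mat n) = carrier ?D"
  proof
    show "split_trace ` range (levi_mat n) \<subseteq> carrier ?D" using carr by auto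
    show "carrier ?D \<subseteq> split_trace ` range (levi_mat n)"
    proof
      fix x assume x: "x \<in> carrier ?D"
      obtain S t where "x = (S, t)" by (cases x)
      with x have S: "S \<in> carrier_mat 2 2" "S $$ (0, 0) + S $$ (1, 1) = 0" and x: "x = (S, t)"
        by (simp_all add: direct_sum_sl2_simps)
      \<comment> \<open>The preimage is S + t/2: since S is traceless, its trace is t.\<close>
      let ?M = "\<lambda>u v. S $$ (u, v) + (if u = v then t / 2 else 0)"
      have tr: "?M 0 0 + ?M 1 1 = t" using S(2) by (simp add: algebra_simps)
      have "S = mat 2 2 (\<lambda>(i, j). ?M i j - (if i = j then t / 2 else 0))"
        using S(1) by (intro eq_matI) simp_all
      then have "x = split_trace (levi_mat n ?M)"
        unfolding split_trace_levi[OF n(1)] tr x by simp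
      then show "x \<in> split_trace ` range (levi_mat n)" by (rule image_eqI) (rule rangeI)
    qed
  qed
  have "bij_betw split_trace (carrier ?L) (carrier ?D)"
    using inj surj by (simp add: bij_betw_def)
  moreover have "\<forall>x\<in>carrier ?L. \<forall>y\<in>carrier ?L.
      split_trace (bracket ?L x y) = bracket ?D (split_trace x) (split_trace y)"
    using bracket by (auto simp: sol_simps(5))
  ultimately show ?thesis unfolding lie_isomorphic_def using L D hom by blast
qed

theorem theorem5p7:
  fixes n :: nat
  assumes "n mod 4 = 2" and "n \<ge> 6"
  shows
    "(\<forall>k\<ge>1. family_direct (sol_A2 n) {k..(n - 2) div 4} (ideal_b n)) \<and>
     ((\<forall>k\<in>{1..(n - 2) div 4}. lie_ideal CC (ideal_b n k) (sol_A2 n)) \<and>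
      (\<forall>k\<ge>1. lie_ideal CC (ideal_a n k) (sol_A2 n))) \<and>
     (\<forall>k\<ge>1. bracket_space CC (sol_A2 n) (ideal_a n k) (ideal_a n k) \<subseteq> ideal_a n (k + 1)) \<and>
     (lie_ideal CC (ideal_a n 1) (sol_A2 n) \<and>
      lie_abelian ((sol_A2 n)\<lparr>carrier := ideal_a n 1\<rparr>) \<and>
      lie_nilpotent CC ((sol_A2 n)\<lparr>carrier := ideal_a n 1\<rparr>)) \<and>
     lie_isomorphic CC
       ((sol_A2 n)\<lparr>carrier := lie_generated CC (sol_A2 n) {el_h1 n, el_h2 n, el_e n, el_f n}\<rparr>)
       (lie_direct_sum (sl 2) lie_C)"
proof (intro conjI allI ballI impI)
  have abelian: "lie_abelian ((sol_A2 n)\<lparr>carrier := ideal_a n 1\<rparr>)"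
    using ideal_a_bracket_zero[OF assms(1), of 1] by (simp add: lie_abelian_def)
  then show "lie_abelian ((sol_A2 n)\<lparr>carrier := ideal_a n 1\<rparr>)" .
  show ideal: "lie_ideal CC (ideal_a n 1) (sol_A2 n)" by (rule ideal_a_lie_ideal[OF assms(1)]) simp
  show "lie_nilpotent CC ((sol_A2 n)\<lparr>carrier := ideal_a n 1\<rparr>)"
    by (rule lie_nilpotent_if_abelian[OF lie_ideal_is_lie[OF ideal] abelian])
  show "lie_isomorphic CC
      ((sol_A2 n)\<lparr>carrier := lie_generated CC (sol_A2 n) {el_h1 n, el_h2 n, el_e n, el_f n}\<rparr>)
      (lie_direct_sum (sl 2) lie_C)"
    unfolding lie_generated_levi[OF assms(1)] by (rule levi_isomorphic[OF assms(1)])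
next
  fix k assume "k \<in> {1..(n - 2) div 4}"
  then have k: "1 \<le> k" by simp
  show "lie_ideal CC (ideal_b n k) (sol_A2 n)"
    unfolding ideal_b_eq[OF assms(1) k] by (rule nil_mat_lie_ideal[OF assms(1) k])
qed (rule ideal_b_direct[OF assms(1)] ideal_a_lie_ideal[OF assms(1)] ideal_a_bracket_space[OF assms(1)],
    assumption)+

end
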